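(* Let $Q$ be a real $m\times n$ matrix with $Q^TQ=I_n$ and coherence $\mu=\max_{1\le j\le m}\|e_j^TQ\|_2^2$. Let $c$ be an integer with $n\le c\le m$, and let $S$ be a random sampling matrix produced, with inputs $m$ and $c$, by any one of the following three methods: uniform sampling without replacement, uniform sampling with replacement, or Bernoulli sampling. Let $0<\epsilon<1$ and $0<\delta<1$. If $$c\ge 3m\mu\,\frac{\ln(2n/\delta)}{\epsilon^2},$$ then with probability at least $1-\delta$ we have $\operatorname{rank}(SQ)=n$ and $\kappa(SQ)\le\sqrt{\frac{1+\epsilon}{1-\epsilon}}$.
   Context: Here $e_1,\dots,e_m$ are the canonical (column) basis vectors of $\mathbb{R}^m$, $\|\cdot\|_2$ is the Euclidean two-norm (for vectors and matrices), and for a real matrix $Z$ of full column rank, $\kappa(Z)\equiv\|Z\|_2\|Z^\dagger\|_2$ is the two-norm condition number, with $Z^\dagger$ the Moore-Penrose inverse. The three sampling methods, for integers $m\ge1$ and $1\le c\le m$: (1) Uniform sampling without replacement: let $k_1,\dots,k_m$ be a uniformly random permutation of $1,\dots,m$, and let $S=\sqrt{m/c}\,\begin{pmatrix}e_{k_1}&\cdots&e_{k_c}\end{pmatrix}^T$, a $c\times m$ matrix. (2) Uniform sampling with replacement: let $k_1,\dots,k_c$ be independent and uniformly distributed on $\{1,\dots,m\}$, and let $S=\sqrt{m/c}\,\begin{pmatrix}e_{k_1}&\cdots&e_{k_c}\end{pmatrix}^T$, a $c\times m$ matrix. (3) Bernoulli sampling: $S$ is the $m\times m$ diagonal matrix whose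 diagonal elements $S_{tt}$, $1\le t\le m$, are independent, with $S_{tt}=\sqrt{m/c}$ with probability $c/m$ and $S_{tt}=0$ with probability $1-c/m$. *)

theory Defs
  imports
    "HOL-Probability.Probability"
    "HOL-Combinatorics.Multiset_Permutations"
    "Jordan_Normal_Form.DL_Rank"
begin

text \<open>Indices are 0-based: the indices \<open>1, \<dots>, m\<close> are rendered as \<open>{..<m}\<close>.\<close>

definition vnorm2 :: "real vec \<Rightarrow> real" where
  "vnorm2 v = sqrt (scalar_prod v v)"

text \<open>The supremum is over the closed unit ball, so that it is over a nonempty set
  (and the norm is \<open>0\<close>) also for a matrix without columns.\<close>

definition mnorm2 :: "real mat \<Rightarrow> real" where
  "mnorm2 A = (SUP v \<in> {v \<in> carrier_vec (dim_col A). vnorm2 v \<le> 1}. vnorm2 (A *\<^sub>v v))"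

text \<open>The four Penrose conditions, which determine \<open>X\<close> uniquely.\<close>

definition is_pinv :: "real mat \<Rightarrow> real mat \<Rightarrow> bool" where
  "is_pinv A X \<longleftrightarrow>
     X \<in> carrier_mat (dim_col A) (dim_row A) \<and>
     A * X * A = A \<and> X * A * X = X \<and>
     transpose_mat (A * X) = A * X \<and> transpose_mat (X * A) = X * A"

definition pinv :: "real mat \<Rightarrow> real mat" where
  "pinv A = (THE X. is_pinv A X)"

definition cond_number :: "real mat \<Rightarrow> real" where
  "cond_number Z = mnorm2 Z * mnorm2 (pinv Z)"

abbreviation mat_rank :: "real mat \<Rightarrow> nat" where
  "mat_rank A \<equiv> vec_space.rank (dim_row A) A"

definition coherence :: "real mat \<Rightarrow> real" where
  "coherence Q = Max ((\<lambda>j. (vnorm2 (row Q j))\<^sup>2) ` {..<dim_row Q})"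

definition sampling_matrix :: "nat \<Rightarrow> nat \<Rightarrow> nat list \<Rightarrow> real mat" where
  "sampling_matrix m c ks =
     sqrt (real m / real c) \<cdot>\<^sub>m mat_of_rows m (map (unit_vec m) ks)"

text \<open>Each sampling method is given by the distribution of the random matrix it produces.\<close>

definition uniform_without_replacement :: "nat \<Rightarrow> nat \<Rightarrow> real mat pmf" where
  "uniform_without_replacement m c =
     map_pmf (\<lambda>ks. sampling_matrix m c (take c ks))
       (pmf_of_set (permutations_of_set {..<m}))"

definition uniform_with_replacement :: "nat \<Rightarrow> nat \<Rightarrow> real mat pmf" where
  "uniform_with_replacement m c =
     map_pmf (sampling_matrix m c) (replicate_pmf c (pmf_of_set {..<m}))"

definition bernoulli_sampling :: "nat \<Rightarrow> nat \<Rightarrow> real mat pmf" where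
  "bernoulli_sampling m c =
     map_pmf (mat_diag m)
       (Pi_pmf {..<m} 0
         (\<lambda>_. map_pmf (\<lambda>b. if b then sqrt (real m / real c) else 0)
                (bernoulli_pmf (real c / real m))))"

end

(*
The Gram matrix of the sampled matrix is a sum Y of rank-one terms p p^T, where p is a row of Q
scaled by sqrt (m/c), and |p|^2 <= k := m mu / c. If all eigenvalues of Y lie in
[1 - eps, 1 + eps], then SQ has full rank and the required condition number. By Markov's
inequality it suffices to bound E tr exp (t Y) by n exp (g), where g = (e^(t k) - 1) / k.

Adding a rank-one term satisfies
tr exp (t (Y + p p^T)) <= tr exp (t Y) + g p^T exp (t Y) p for either sign of t. Averaging over
the next sampled row multiplies E tr exp (t Y) by at most 1 + g/c: with replacement because the
terms p p^T average to I/c, without replacement by an additional correlation inequality for the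
eigenvalues of Y. Bernoulli sampling, conditioned on the number K of chosen rows, is sampling
without replacement, so its bound is a binomial mixture of the bounds n (1 + g/c)^K. Neither
Lieb's concavity theorem nor a convex comparison of the sampling schemes is needed.
*)

theory Submission
  imports
    Defs
    "HOL-Real_Asymp.Real_Asymp"
    "Jordan_Normal_Form.Spectral_Radius"
    "Jordan_Normal_Form.Schur_Decomposition"
begin

text \<open>The obstacle is that the sum so far and the next outer product do not commute, so the
  exponential of their sum does not factor. The eigenbases before and after an update are therefore
  compared pair by pair: an eigenvalue difference times the overlap of the two eigenvectors is
  explicit, each trace becomes a double sum, and scalar convexity of exp applies to every summand.
  The update bound is linear in p p^T for fixed Y, so averaging it only involves the mean of p p^T.
  Positive t controls the largest eigenvalue and negative t the smallest; as g has the sign of t,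
  the intermediate inequalities carry a factor t or g to survive the change of sign. Constants: t =
  ln (1 + x) / k with x = eps or x = - eps minimises g - t (1 + x) and makes it (x - (1 + x) ln (1 +
  x)) / k. This is at most - eps^2 / (3 k), the origin of the 3. In 2 n / delta, the n is the trace
  of exp 0 before any draw, and the 2 pays for the two tails.\<close>

unbundle no inner_syntax

section \<open>The spectral theorem\<close>

lemma scalar_prod_self_nonneg: "0 \<le> scalar_prod v (v :: real vec)"
  by (auto simp: scalar_prod_def intro: sum_nonneg)

lemma scalar_prod_self_eq_0_iff:
  fixes v :: "real vec"
  assumes "v \<in> carrier_vec n"
  shows "v \<bullet> v = 0 \<longleftrightarrow> v = 0\<^sub>v n"
proof
  assume "v \<bullet> v = 0"
  then have "\<forall>i\<in>{0..<dim_vec v}. v $ i * v $ i = 0"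
    unfolding scalar_prod_def by (subst (asm) sum_nonneg_eq_0_iff) auto
  then show "v = 0\<^sub>v n" using assms by (intro eq_vecI) auto
qed (use assms in auto)

lemma symmetric_scalar_prod:
  fixes M :: "real mat"
  assumes "M \<in> carrier_mat n n" "transpose_mat M = M" "x \<in> carrier_vec n" "y \<in> carrier_vec n"
  shows "x \<bullet> (M *\<^sub>v y) = (M *\<^sub>v x) \<bullet> y"
  using transpose_vec_mult_scalar[OF assms(1,4,3)] assms(2) by simp

lemma unit_eigenvector:
  fixes M :: "real mat"
  assumes M: "M \<in> carrier_mat n n" and v: "v \<in> carrier_vec n" "v \<noteq> 0\<^sub>v n"
    and ev: "M *\<^sub>v v = e \<cdot>\<^sub>v v"
  shows "\<exists>u \<in> carrier_vec n. u \<bullet> u = 1 \<and> M *\<^sub>v u = e \<cdot>\<^sub>v u"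
proof -
  define r where "r = sqrt (v \<bullet> v)"
  have pos: "v \<bullet> v > 0"
    using scalar_prod_self_nonneg[of v] scalar_prod_self_eq_0_iff[OF v(1)] v(2) by auto
  then have r: "r > 0" "r * r = v \<bullet> v" by (auto simp: r_def)
  let ?u = "(1 / r) \<cdot>\<^sub>v v"
  have "?u \<bullet> ?u = 1 / r * (1 / r * (v \<bullet> v))"
    using v by simp
  also have "\<dots> = 1" using r by (simp add: r(2)[symmetric])
  finally have "?u \<bullet> ?u = 1" .
  moreover have "M *\<^sub>v ?u = e \<cdot>\<^sub>v ?u"
    using M v ev by (simp add: mult_mat_vec[of M n n v] smult_smult_assoc mult.commute)
  ultimately show ?thesis using v by (intro bexI[of _ ?u]) auto
qed

text \<open>A complex eigenvector \<open>p + \<i> q\<close> with eigenvalue \<open>a + \<i> b\<close> satisfies \<open>M p = a p - b q\<close> and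
  \<open>M q = b p + a q\<close>; symmetry of \<open>M\<close> forces \<open>b = 0\<close>, so \<open>p\<close> or \<open>q\<close> is a real eigenvector.\<close>

lemma symmetric_has_unit_eigenvector:
  fixes M :: "real mat"
  assumes M: "M \<in> carrier_mat n n" and sym: "transpose_mat M = M" and n: "n > 0"
  shows "\<exists>e. \<exists>u \<in> carrier_vec n. u \<bullet> u = 1 \<and> M *\<^sub>v u = e \<cdot>\<^sub>v u"
proof -
  let ?C = "map_mat complex_of_real M"
  have "?C \<in> carrier_mat n n" using M by simp
  from spectrum_non_empty[OF this n] obtain z where "eigenvalue ?C z"
    unfolding spectrum_def by auto
  then obtain x where x: "x \<in> carrier_vec n" "x \<noteq> 0\<^sub>v n" and ev: "?C *\<^sub>v x = z \<cdot>\<^sub>v x"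
    using M unfolding eigenvalue_def eigenvector_def by auto
  define p where "p = map_vec Re x"
  define q where "q = map_vec Im x"
  define a where "a = Re z"
  define b where "b = Im z"
  have pq [simp]: "p \<in> carrier_vec n" "q \<in> carrier_vec n" using x by (auto simp: p_def q_def)
  have row: "(\<Sum>j\<in>{0..<n}. complex_of_real (M $$ (i, j)) * x $ j) = z * x $ i" if "i < n" for i
  proof -
    have "(?C *\<^sub>v x) $ i = (z \<cdot>\<^sub>v x) $ i" by (simp add: ev)
    then show ?thesis using M x that by (simp add: scalar_prod_def)
  qed
  have Mp: "M *\<^sub>v p = a \<cdot>\<^sub>v p - b \<cdot>\<^sub>v q"
  proof (rule eq_vecI)
    fix i assume "i < dim_vec (a \<cdot>\<^sub>v p - b \<cdot>\<^sub>v q)"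
    then have i: "i < n" using x by (simp add: q_def)
    from arg_cong[OF row[OF i], of Re] show "(M *\<^sub>v p) $ i = (a \<cdot>\<^sub>v p - b \<cdot>\<^sub>v q) $ i"
      using M x i by (simp add: scalar_prod_def p_def q_def a_def b_def)
  qed (use M x in \<open>simp add: q_def\<close>)
  have Mq: "M *\<^sub>v q = b \<cdot>\<^sub>v p + a \<cdot>\<^sub>v q"
  proof (rule eq_vecI)
    fix i assume "i < dim_vec (b \<cdot>\<^sub>v p + a \<cdot>\<^sub>v q)"
    then have i: "i < n" using x by (simp add: q_def)
    from arg_cong[OF row[OF i], of Im] show "(M *\<^sub>v q) $ i = (b \<cdot>\<^sub>v p + a \<cdot>\<^sub>v q) $ i"
      using M x i by (simp add: scalar_prod_def p_def q_def a_def b_def)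
  qed (use M x in \<open>simp add: q_def\<close>)
  have "p \<bullet> (M *\<^sub>v q) = (M *\<^sub>v p) \<bullet> q"
    by (rule symmetric_scalar_prod[OF M sym]) auto
  then have "b * (p \<bullet> p) + a * (p \<bullet> q) = a * (p \<bullet> q) - b * (q \<bullet> q)"
    by (simp add: Mp Mq scalar_prod_add_distrib[of p n] minus_scalar_prod_distrib[of _ n]
        scalar_prod_smult_distrib[of p n] smult_scalar_prod_distrib[of _ n])
  then have "b * (p \<bullet> p + q \<bullet> q) = 0" by (simp add: algebra_simps)
  moreover have nz: "p \<noteq> 0\<^sub>v n \<or> q \<noteq> 0\<^sub>v n"
  proof (rule ccontr)
    assume "\<not> ?thesis"
    then have *: "p $ i = 0" "q $ i = 0" if "i < n" for i using that by auto
    have "x = 0\<^sub>v n"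
    proof (rule eq_vecI)
      fix i assume "i < dim_vec (0\<^sub>v n :: complex vec)"
      then show "x $ i = 0\<^sub>v n $ i" using *[of i] x by (simp add: p_def q_def complex_eq_iff)
    qed (use x in auto)
    with x show False by simp
  qed
  then have "p \<bullet> p + q \<bullet> q \<noteq> 0"
    using scalar_prod_self_nonneg[of p] scalar_prod_self_nonneg[of q]
      scalar_prod_self_eq_0_iff[of p n] scalar_prod_self_eq_0_iff[of q n] by auto
  ultimately have b: "b = 0" by simp
  have "M *\<^sub>v p = a \<cdot>\<^sub>v p" "M *\<^sub>v q = a \<cdot>\<^sub>v q"
    unfolding Mp Mq b using carrier_vecD[OF pq(1)] carrier_vecD[OF pq(2)]
    by (auto intro!: eq_vecI simp del: pq)
  with nz unit_eigenvector[OF M] pq show ?thesis by blast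
qed

text \<open>Deflation: the columns of \<open>J\<close> are an orthonormal basis of the complement of
  \<open>v\<close>, and the last conjunct says that \<open>J * transpose_mat J\<close> is the
  identity there. They come from Gram-Schmidt applied to a basis starting with
  \<open>v\<close>.\<close>

lemma orthonormal_completion:
  fixes v :: "real vec"
  assumes v: "v \<in> carrier_vec (Suc k)" and "v \<bullet> v = 1"
  shows "\<exists>J \<in> carrier_mat (Suc k) k. transpose_mat J * J = 1\<^sub>m k \<and> transpose_mat J *\<^sub>v v = 0\<^sub>v k \<and>
    (\<forall>x \<in> carrier_vec (Suc k). v \<bullet> x = 0 \<longrightarrow> J *\<^sub>v (transpose_mat J *\<^sub>v x) = x)"
proof -
  let ?n = "Suc k"
  have v0: "v \<noteq> 0\<^sub>v ?n" using assms scalar_prod_self_eq_0_iff[of v ?n] by auto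
  interpret cof_vec_space ?n "TYPE(real)" .
  define b where "b = basis_completion v"
  define ws where "ws = gram_schmidt ?n b"
  note bc = basis_completion[OF v v0, folded b_def]
  note gs = gram_schmidt_result[OF bc(2,4,5) refl, folded ws_def]
  have len: "length ws = ?n" using gs bc by simp
  have hd: "ws ! 0 = v"
  proof -
    obtain vs where "b = v # vs" using bc by (cases b) auto
    then have "hd ws = v" using gram_schmidt_hd[OF v, of vs] by (simp add: ws_def)
    then show ?thesis using len by (cases ws) auto
  qed
  \<comment> \<open>Gram-Schmidt speaks of the conjugate inner product, which over the reals is the
    ordinary one.\<close>
  have conj: "conjugate w = w" for w :: "real vec" by (rule eq_vecI) auto
  have car: "ws ! i \<in> carrier_vec ?n" if "i < ?n" for i using gs(3) len that by auto
  have orth: "ws ! i \<bullet> ws ! j = 0 \<longleftrightarrow> i \<noteq> j" if "i < ?n" "j < ?n" for i j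
    using corthogonalD[OF gs(2)] len that by (simp add: conj)
  \<comment> \<open>Gram-Schmidt gives orthogonal vectors of arbitrary length; they still have to be
    normalised.\<close>
  define u where "u i = (1 / sqrt (ws ! i \<bullet> ws ! i)) \<cdot>\<^sub>v (ws ! i)" for i
  have ucar: "u i \<in> carrier_vec ?n" if "i < ?n" for i using car[OF that] by (simp add: u_def)
  have uorth: "u i \<bullet> u j = (if i = j then 1 else 0)" if "i < ?n" "j < ?n" for i j
  proof -
    have "u i \<bullet> u j = 1 / sqrt (ws ! i \<bullet> ws ! i) * (1 / sqrt (ws ! j \<bullet> ws ! j)) * (ws ! i \<bullet> ws ! j)"
      using car[OF that(1)] car[OF that(2)] by (simp add: u_def)
    moreover have "ws ! i \<bullet> ws ! i > 0"
      using orth[of i i] that scalar_prod_self_nonneg[of "ws ! i"] by (simp add: less_le)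
    ultimately show ?thesis using orth[OF that] by auto
  qed
  have u0: "u 0 = v" using hd assms by (simp add: u_def)
  define W where "W = mat ?n ?n (\<lambda>(i, j). u j $ i)"
  define J where "J = mat ?n k (\<lambda>(i, j). u (Suc j) $ i)"
  have W: "W \<in> carrier_mat ?n ?n" and J: "J \<in> carrier_mat ?n k" by (auto simp: W_def J_def)
  have colW: "col W j = u j" if "j < ?n" for j using ucar[OF that] that by (auto simp: W_def)
  have colJ: "col J j = u (Suc j)" if "j < k" for j using ucar[of "Suc j"] that by (auto simp: J_def)
  have WTW: "transpose_mat W * W = 1\<^sub>m ?n"
    using W by (intro eq_matI) (auto simp: colW uorth)
  then have WWT: "W * transpose_mat W = 1\<^sub>m ?n"
    using W by (intro mat_mult_left_right_inverse[of "transpose_mat W" ?n W]) auto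
  have 1: "transpose_mat J * J = 1\<^sub>m k"
    using J by (intro eq_matI) (auto simp: colJ uorth)
  have 2: "transpose_mat J *\<^sub>v v = 0\<^sub>v k"
    using J by (intro eq_vecI) (auto simp: colJ u0[symmetric] uorth)
  have "J *\<^sub>v (transpose_mat J *\<^sub>v x) = x" if x: "x \<in> carrier_vec ?n" and "v \<bullet> x = 0" for x
  proof (rule eq_vecI)
    fix i assume "i < dim_vec x"
    then have i: "i < ?n" using x by simp
    \<comment> \<open>Expand \<open>x\<close> in the orthonormal basis; the coefficient at
      \<open>u 0 = v\<close> vanishes, and what remains is the action of \<open>J\<close>.\<close>
    have "x $ i = ((W * transpose_mat W) *\<^sub>v x) $ i" using WWT x by simp
    also have "\<dots> = (W *\<^sub>v (transpose_mat W *\<^sub>v x)) $ i" using W x by simp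
    also have "\<dots> = (\<Sum>j\<in>{0..<?n}. u j $ i * (u j \<bullet> x))"
      using W i by (simp add: scalar_prod_def[of "row W i"] colW) (simp add: W_def)
    also have "\<dots> = u 0 $ i * (u 0 \<bullet> x) + (\<Sum>j\<in>{0..<k}. u (Suc j) $ i * (u (Suc j) \<bullet> x))"
      by (simp only: sum.atLeast0_lessThan_Suc_shift) simp
    also have "u 0 \<bullet> x = 0" using that u0 by simp
    also have "u 0 $ i * 0 + (\<Sum>j\<in>{0..<k}. u (Suc j) $ i * (u (Suc j) \<bullet> x)) =
        (J *\<^sub>v (transpose_mat J *\<^sub>v x)) $ i"
      using J i by (simp add: scalar_prod_def[of "row J i"] colJ) (simp add: J_def)
    finally show "(J *\<^sub>v (transpose_mat J *\<^sub>v x)) $ i = x $ i" ..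
  qed (use J x in auto)
  with J 1 2 show ?thesis by blast
qed

text \<open>Only indices below \<open>n\<close> are constrained. Completeness is not demanded,
  because \<open>n\<close> orthonormal vectors in dimension \<open>n\<close> already form a
  basis.\<close>

definition eigensystem :: "nat \<Rightarrow> real mat \<Rightarrow> (nat \<Rightarrow> real vec) \<Rightarrow> (nat \<Rightarrow> real) \<Rightarrow> bool" where
  "eigensystem n M u a \<longleftrightarrow>
     (\<forall>i<n. u i \<in> carrier_vec n \<and> M *\<^sub>v u i = a i \<cdot>\<^sub>v u i) \<and>
     (\<forall>i<n. \<forall>j<n. u i \<bullet> u j = (if i = j then 1 else 0))"

text \<open>Induction by deflation: split off one unit eigenvector \<open>v\<close>, compress
  \<open>M\<close> to the complement of \<open>v\<close> by \<open>J\<close>, and lift the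
  eigenvectors of the compression back through \<open>J\<close>.\<close>

lemma spectral_theorem:
  fixes M :: "real mat"
  assumes "M \<in> carrier_mat n n" and "transpose_mat M = M"
  shows "\<exists>u a. eigensystem n M u a"
  using assms
proof (induction n arbitrary: M)
  case 0
  then show ?case by (auto simp: eigensystem_def)
next
  case (Suc k)
  note M = Suc.prems(1) and sym = Suc.prems(2)
  from symmetric_has_unit_eigenvector[OF M sym] obtain e v where
    v: "v \<in> carrier_vec (Suc k)" "v \<bullet> v = 1" "M *\<^sub>v v = e \<cdot>\<^sub>v v" by auto
  from orthonormal_completion[OF v(1,2)] obtain J where
    J: "J \<in> carrier_mat (Suc k) k" and JTJ: "transpose_mat J * J = 1\<^sub>m k"
    and Jv: "transpose_mat J *\<^sub>v v = 0\<^sub>v k"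
    and Jx: "\<And>x. x \<in> carrier_vec (Suc k) \<Longrightarrow> v \<bullet> x = 0 \<Longrightarrow> J *\<^sub>v (transpose_mat J *\<^sub>v x) = x"
    by blast
  have JT: "transpose_mat J \<in> carrier_mat k (Suc k)" using J by simp
  have Jperp: "v \<bullet> (J *\<^sub>v w) = 0" if "w \<in> carrier_vec k" for w
    using transpose_vec_mult_scalar[OF J that v(1)] Jv that by simp
  let ?B = "transpose_mat J * (M * J)"
  have MJ: "M * J \<in> carrier_mat (Suc k) k" using M J by simp
  have "transpose_mat ?B = transpose_mat (M * J) * transpose_mat (transpose_mat J)"
    by (rule transpose_mult[OF JT MJ])
  also have "\<dots> = (transpose_mat J * M) * J"
    using transpose_mult[OF M J] sym by simp
  also have "\<dots> = ?B" using J JT M by simp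
  finally have symB: "transpose_mat ?B = ?B" .
  have B: "?B \<in> carrier_mat k k" using JT MJ by simp
  from Suc.IH[OF B symB] obtain w b where wb: "eigensystem k ?B w b" by auto
  then have wcar: "w i \<in> carrier_vec k" and wev: "?B *\<^sub>v w i = b i \<cdot>\<^sub>v w i" if "i < k" for i
    using that by (auto simp: eigensystem_def)
  have worth: "w i \<bullet> w j = (if i = j then 1 else 0)" if "i < k" "j < k" for i j
    using wb that by (auto simp: eigensystem_def)
  have Jw: "J *\<^sub>v w i \<in> carrier_vec (Suc k)" if "i < k" for i using J wcar[OF that] by simp
  have ev: "M *\<^sub>v (J *\<^sub>v w i) = b i \<cdot>\<^sub>v (J *\<^sub>v w i)" if "i < k" for i
  proof -
    note w = wcar[OF that]
    have Mw: "M *\<^sub>v (J *\<^sub>v w i) \<in> carrier_vec (Suc k)" using M Jw[OF that] by simp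
    \<comment> \<open>The complement of \<open>v\<close> is invariant under \<open>M\<close>, so
      compressing to it and lifting back loses nothing of the image.\<close>
    have "v \<bullet> (M *\<^sub>v (J *\<^sub>v w i)) = (M *\<^sub>v v) \<bullet> (J *\<^sub>v w i)"
      by (rule symmetric_scalar_prod[OF M sym v(1) Jw[OF that]])
    also have "\<dots> = 0" using v Jw[OF that] Jperp[OF w] by simp
    finally have "M *\<^sub>v (J *\<^sub>v w i) = J *\<^sub>v (transpose_mat J *\<^sub>v (M *\<^sub>v (J *\<^sub>v w i)))"
      using Jx[OF Mw] by simp
    also have "transpose_mat J *\<^sub>v (M *\<^sub>v (J *\<^sub>v w i)) = ?B *\<^sub>v w i"
      using assoc_mult_mat_vec[OF JT MJ w] assoc_mult_mat_vec[OF M J w] by simp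
    also have "J *\<^sub>v \<dots> = b i \<cdot>\<^sub>v (J *\<^sub>v w i)"
      unfolding wev[OF that] by (rule mult_mat_vec[OF J w])
    finally show ?thesis .
  qed
  have orth: "(J *\<^sub>v w i) \<bullet> (J *\<^sub>v w j) = (if i = j then 1 else 0)" if "i < k" "j < k" for i j
  proof -
    have "(J *\<^sub>v w i) \<bullet> (J *\<^sub>v w j) = (transpose_mat J *\<^sub>v (J *\<^sub>v w i)) \<bullet> w j"
      using transpose_vec_mult_scalar[OF J wcar[OF that(2)] Jw[OF that(1)]] by simp
    also have "transpose_mat J *\<^sub>v (J *\<^sub>v w i) = w i"
      using assoc_mult_mat_vec[OF JT J wcar[OF that(1)]] JTJ wcar[OF that(1)] by simp
    finally show ?thesis using worth[OF that] by simp
  qed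
  define u where "u i = (case i of 0 \<Rightarrow> v | Suc j \<Rightarrow> J *\<^sub>v w j)" for i
  define a where "a i = (case i of 0 \<Rightarrow> e | Suc j \<Rightarrow> b j)" for i
  have "(J *\<^sub>v w i) \<bullet> v = 0" if "i < k" for i
    using Jperp[OF wcar[OF that]] comm_scalar_prod[OF v(1) Jw[OF that]] by simp
  then have "eigensystem (Suc k) M u a"
    unfolding eigensystem_def u_def a_def
    using v ev orth Jw Jperp wcar by (auto split: nat.splits)
  then show ?case by blast
qed

text \<open>The square matrix \<open>U\<close> of eigenvectors has a left inverse, its transpose,
  which is therefore a right inverse as well.\<close>

lemma eigensystem_parseval:
  assumes "eigensystem n M u a" and x: "x \<in> carrier_vec n" and y: "y \<in> carrier_vec n"
  shows "(\<Sum>i<n. (u i \<bullet> x) * (u i \<bullet> y)) = x \<bullet> y"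
proof -
  have ucar: "u i \<in> carrier_vec n" if "i < n" for i
    using assms(1) that by (auto simp: eigensystem_def)
  define U where "U = mat n n (\<lambda>(i, j). u j $ i)"
  have U: "U \<in> carrier_mat n n" by (simp add: U_def)
  have col: "col U j = u j" if "j < n" for j using ucar[OF that] that by (auto simp: U_def)
  have "transpose_mat U * U = 1\<^sub>m n"
    using U assms(1) by (intro eq_matI) (auto simp: col eigensystem_def)
  then have UUT: "U * transpose_mat U = 1\<^sub>m n"
    using U by (intro mat_mult_left_right_inverse[of "transpose_mat U" n U]) auto
  have "x \<bullet> y = x \<bullet> (U *\<^sub>v (transpose_mat U *\<^sub>v y))"
    using assoc_mult_mat_vec[OF U _ y, of "transpose_mat U"] U UUT y by simp
  also have "\<dots> = (transpose_mat U *\<^sub>v x) \<bullet> (transpose_mat U *\<^sub>v y)"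
    using transpose_vec_mult_scalar[OF U _ x, of "transpose_mat U *\<^sub>v y"] U y by simp
  also have "\<dots> = (\<Sum>i<n. (u i \<bullet> x) * (u i \<bullet> y))"
    using U by (simp add: scalar_prod_def[of "transpose_mat U *\<^sub>v x"] col lessThan_atLeast0)
  finally show ?thesis ..
qed

section \<open>The exponential trace under rank-one updates\<close>

text \<open>\<open>eigvec\<close> and \<open>eigval\<close> project the same \<open>SOME\<close>
  term, so vectors and values belong to one eigensystem.\<close>

definition eigvec :: "real mat \<Rightarrow> nat \<Rightarrow> real vec" where
  "eigvec M = fst (SOME (u, a). eigensystem (dim_row M) M u a)"

definition eigval :: "real mat \<Rightarrow> nat \<Rightarrow> real" where
  "eigval M = snd (SOME (u, a). eigensystem (dim_row M) M u a)"

lemma eigensystem_eigvec_eigval: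
  assumes "M \<in> carrier_mat n n" and "transpose_mat M = M"
  shows "eigensystem n M (eigvec M) (eigval M)"
proof -
  obtain u a where "eigensystem (dim_row M) M u a" using spectral_theorem assms by blast
  then have "case (u, a) of (u, a) \<Rightarrow> eigensystem (dim_row M) M u a" by simp
  from someI[of "\<lambda>(u, a). eigensystem (dim_row M) M u a", OF this]
  show ?thesis using assms by (simp add: eigvec_def eigval_def split: prod.splits)
qed

text \<open>\<open>exp_trace \<theta> M\<close> and \<open>exp_form \<theta> M q\<close> are the trace of \<open>e\<^bsup>\<theta>M\<^esup>\<close> and the value at \<open>q\<close> of its
  quadratic form, expressed in an eigenbasis of \<open>M\<close> so that no matrix exponential is needed.\<close>

definition exp_trace :: "real \<Rightarrow> real mat \<Rightarrow> real" where
  "exp_trace \<theta> M = (\<Sum>i<dim_row M. exp (\<theta> * eigval M i))"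

definition exp_form :: "real \<Rightarrow> real mat \<Rightarrow> real vec \<Rightarrow> real" where
  "exp_form \<theta> M q = (\<Sum>i<dim_row M. exp (\<theta> * eigval M i) * (eigvec M i \<bullet> q)\<^sup>2)"

definition outer :: "real vec \<Rightarrow> real mat" where
  "outer q = mat (dim_vec q) (dim_vec q) (\<lambda>(i, j). q $ i * q $ j)"

lemma outer_carrier [simp]: "q \<in> carrier_vec n \<Longrightarrow> outer q \<in> carrier_mat n n"
  by (auto simp: outer_def)

lemma outer_dim [simp]: "dim_row (outer q) = dim_vec q" "dim_col (outer q) = dim_vec q"
  by (auto simp: outer_def)

lemma symmetric_add_outer:
  assumes "M \<in> carrier_mat n n" "transpose_mat M = M" "q \<in> carrier_vec n"
  shows "transpose_mat (M + s \<cdot>\<^sub>m outer q) = M + s \<cdot>\<^sub>m outer q"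
proof (rule eq_matI)
  fix i j assume "i < dim_row (M + s \<cdot>\<^sub>m outer q)" "j < dim_col (M + s \<cdot>\<^sub>m outer q)"
  then have ij: "i < n" "j < n" using assms by auto
  have "M $$ (j, i) = transpose_mat M $$ (i, j)" using ij assms(1) by simp
  then have "M $$ (j, i) = M $$ (i, j)" using assms(2) by simp
  then show "transpose_mat (M + s \<cdot>\<^sub>m outer q) $$ (i, j) = (M + s \<cdot>\<^sub>m outer q) $$ (i, j)"
    using ij assms by (simp add: outer_def)
qed (use assms in auto)

lemma add_outer_mult_vec:
  assumes "M \<in> carrier_mat n n" "q \<in> carrier_vec n" "x \<in> carrier_vec n"
  shows "(M + s \<cdot>\<^sub>m outer q) *\<^sub>v x = M *\<^sub>v x + (s * (q \<bullet> x)) \<cdot>\<^sub>v q"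
  using assms
  by (intro eq_vecI)
    (auto simp: scalar_prod_def outer_def sum.distrib sum_distrib_left sum_distrib_right
      algebra_simps)

text \<open>The tangent of exp at \<open>y\<close> lies below the graph. No order of
  \<open>x\<close> and \<open>y\<close> is assumed, which lets it serve both signs of
  \<theta>.\<close>

lemma exp_diff_le_mult: "exp (y::real) - exp x \<le> (y - x) * exp y"
proof -
  have "1 + (x - y) \<le> exp (x - y)" by (rule exp_ge_add_one_self)
  then have "exp y * (1 + (x - y)) \<le> exp y * exp (x - y)" by (intro mult_left_mono) auto
  also have "\<dots> = exp x" by (simp add: exp_add[symmetric])
  finally show ?thesis by (simp add: algebra_simps)
qed

text \<open>The trapezoidal rule overestimates the integral of a convex function.\<close>

lemma exp_diff_le_trapezoid:
  fixes x y :: real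
  assumes "x \<le> y"
  shows "exp y - exp x \<le> (y - x) * (exp x + exp y) / 2"
proof -
  \<comment> \<open>After division by \<open>exp x\<close>, the trapezoid error depends on
    \<open>t = y - x\<close> only, and is \<open>h t\<close>.\<close>
  define h where "h t = t * (1 + exp t) / 2 - exp t + 1" for t :: real
  have "h 0 \<le> h (y - x)"
  proof (rule DERIV_nonneg_imp_nondecreasing[of 0 "y - x" h])
    fix t :: real
    have "(h has_real_derivative (1 + exp t + t * exp t) / 2 - exp t) (at t)"
        unfolding h_def by (auto intro!: derivative_eq_intros simp: field_simps)
    moreover have "0 \<le> (1 + exp t + t * exp t) / 2 - exp t"
      using exp_diff_le_mult[of t 0] by simp
    ultimately show "\<exists>d. (h has_real_derivative d) (at t) \<and> 0 \<le> d" by blast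
  qed (use assms in simp)
  then have "0 \<le> exp x * h (y - x)" by (simp add: h_def)
  also have "\<dots> = (y - x) * (exp x + exp x * exp (y - x)) / 2 - exp x * exp (y - x) + exp x"
    by (simp add: h_def algebra_simps add_divide_distrib diff_divide_distrib)
  also have "exp x * exp (y - x) = exp y" by (simp add: exp_add[symmetric])
  finally show ?thesis by simp
qed

text \<open>One step of a discretised differential equation along \<open>q\<close>. Convexity of exp
  yields the trace bound with the form at the end point, and the form bound as an implicit
  trapezoidal step. Both keep the factor \<theta>, so that they hold for either sign.\<close>

lemma rank_one_step:
  assumes M: "M \<in> carrier_mat n n" "transpose_mat M = M" and q: "q \<in> carrier_vec n"
    and s: "s \<ge> 0" and \<kappa>: "q \<bullet> q \<le> \<kappa>"
  defines "M' \<equiv> M + s \<cdot>\<^sub>m outer q"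
  shows "exp_trace \<theta> M' - exp_trace \<theta> M \<le> \<theta> * s * exp_form \<theta> M' q" (is ?trace)
    and "\<theta> * (exp_form \<theta> M' q - exp_form \<theta> M q) \<le>
      \<theta>\<^sup>2 * s * \<kappa> * (exp_form \<theta> M q + exp_form \<theta> M' q) / 2" (is ?form)
proof -
  have M': "M' \<in> carrier_mat n n" "transpose_mat M' = M'"
    using M q symmetric_add_outer[OF M q] by (auto simp: M'_def)
  define u a v b where "u = eigvec M" and "a = eigval M" and "v = eigvec M'" and "b = eigval M'"
  have sys: "eigensystem n M u a" "eigensystem n M' v b"
    using eigensystem_eigvec_eigval M M' by (auto simp: u_def a_def v_def b_def)
  have u: "u i \<in> carrier_vec n" "M *\<^sub>v u i = a i \<cdot>\<^sub>v u i" "u i \<bullet> u i = 1" if "i < n" for i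
    using sys(1) that by (auto simp: eigensystem_def)
  have v: "v i \<in> carrier_vec n" "M' *\<^sub>v v i = b i \<cdot>\<^sub>v v i" "v i \<bullet> v i = 1" if "i < n" for i
    using sys(2) that by (auto simp: eigensystem_def)
  define w where "w i j = u i \<bullet> v j" for i j
  define \<alpha> where "\<alpha> i = u i \<bullet> q" for i
  define \<beta> where "\<beta> j = v j \<bullet> q" for j
  \<comment> \<open>The entry of \<open>M' - M\<close> between \<open>u i\<close> and
    \<open>v j\<close>, computed in two ways. This replaces a common eigenbasis.\<close>
  have cross: "(b j - a i) * w i j = s * \<alpha> i * \<beta> j" if "i < n" "j < n" for i j
  proof -
    note uv = u[OF that(1)] v[OF that(2)]
    have "b j * w i j = u i \<bullet> (M' *\<^sub>v v j)"
      using uv by (simp add: w_def scalar_prod_smult_distrib[of _ n])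
    also have "\<dots> = u i \<bullet> (M *\<^sub>v v j) + s * (q \<bullet> v j) * (u i \<bullet> q)"
      unfolding M'_def add_outer_mult_vec[OF M(1) q uv(4)] using M uv q
      by (simp add: scalar_prod_add_distrib[of _ n] scalar_prod_smult_distrib[of _ n])
    also have "u i \<bullet> (M *\<^sub>v v j) = a i * w i j"
      using symmetric_scalar_prod[OF M uv(1,4)] uv by (simp add: w_def)
    also have "q \<bullet> v j = \<beta> j" using comm_scalar_prod[OF q uv(4)] by (simp add: \<beta>_def)
    finally show ?thesis by (simp add: \<alpha>_def algebra_simps)
  qed
  have w_row: "(\<Sum>j<n. (w i j)\<^sup>2) = 1" if "i < n" for i
  proof -
    have "(\<Sum>j<n. (w i j)\<^sup>2) = (\<Sum>j<n. (v j \<bullet> u i) * (v j \<bullet> u i))"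
      using that u v by (intro sum.cong) (auto simp: w_def power2_eq_square comm_scalar_prod[of "u i" n])
    then show ?thesis using eigensystem_parseval[OF sys(2) u(1) u(1), OF that that] u(3)[OF that] by simp
  qed
  have w_col: "(\<Sum>i<n. (w i j)\<^sup>2) = 1" if "j < n" for j
    using eigensystem_parseval[OF sys(1) v(1) v(1), OF that that] v(3)[OF that]
    by (simp add: w_def power2_eq_square)
  have w_\<alpha>: "(\<Sum>i<n. w i j * \<alpha> i) = \<beta> j" if "j < n" for j
    using eigensystem_parseval[OF sys(1) v(1)[OF that] q] by (simp add: w_def \<alpha>_def \<beta>_def)
  have w_\<beta>: "(\<Sum>j<n. w i j * \<beta> j) = \<alpha> i" if "i < n" for i
  proof -
    have "(\<Sum>j<n. w i j * \<beta> j) = (\<Sum>j<n. (v j \<bullet> u i) * (v j \<bullet> q))"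
      using that u v by (intro sum.cong) (auto simp: w_def \<beta>_def comm_scalar_prod[of "u i" n])
    then show ?thesis using eigensystem_parseval[OF sys(2) u(1)[OF that] q] by (simp add: \<alpha>_def)
  qed
  have \<alpha>2: "(\<Sum>i<n. (\<alpha> i)\<^sup>2) = q \<bullet> q"
    using eigensystem_parseval[OF sys(1) q q] by (simp add: \<alpha>_def power2_eq_square)
  have \<beta>2: "(\<Sum>i<n. (\<beta> i)\<^sup>2) = q \<bullet> q"
    using eigensystem_parseval[OF sys(2) q q] by (simp add: \<beta>_def power2_eq_square)
  have T: "exp_trace \<theta> M = (\<Sum>i<n. exp (\<theta> * a i))" "exp_trace \<theta> M' = (\<Sum>j<n. exp (\<theta> * b j))"
    using M M' by (auto simp: exp_trace_def a_def b_def)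
  have H: "exp_form \<theta> M q = (\<Sum>i<n. exp (\<theta> * a i) * (\<alpha> i)\<^sup>2)"
     "exp_form \<theta> M' q = (\<Sum>j<n. exp (\<theta> * b j) * (\<beta> j)\<^sup>2)"
    using M M' by (auto simp: exp_form_def a_def b_def \<alpha>_def \<beta>_def u_def v_def)
  \<comment> \<open>The squared overlaps form a doubly stochastic matrix, so both traces can be
    spread over the same index pairs.\<close>
  have "exp_trace \<theta> M' = (\<Sum>i<n. \<Sum>j<n. (w i j)\<^sup>2 * exp (\<theta> * b j))"
    unfolding T by (subst sum.swap) (simp add: w_col flip: sum_distrib_right)
  moreover have "exp_trace \<theta> M = (\<Sum>i<n. \<Sum>j<n. (w i j)\<^sup>2 * exp (\<theta> * a i))"
    unfolding T by (simp add: w_row flip: sum_distrib_right)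
  ultimately have "exp_trace \<theta> M' - exp_trace \<theta> M =
      (\<Sum>i<n. \<Sum>j<n. (w i j)\<^sup>2 * (exp (\<theta> * b j) - exp (\<theta> * a i)))"
    by (simp add: sum_subtractf right_diff_distrib)
  also have "\<dots> \<le> (\<Sum>i<n. \<Sum>j<n. \<theta> * s * exp (\<theta> * b j) * \<beta> j * (w i j * \<alpha> i))"
  proof (intro sum_mono)
    fix i j assume ij: "i \<in> {..<n}" "j \<in> {..<n}"
    have "(w i j)\<^sup>2 * (exp (\<theta> * b j) - exp (\<theta> * a i)) \<le>
        (w i j)\<^sup>2 * ((\<theta> * b j - \<theta> * a i) * exp (\<theta> * b j))"
      by (intro mult_left_mono exp_diff_le_mult) auto
    also have "\<dots> = \<theta> * ((b j - a i) * w i j) * w i j * exp (\<theta> * b j)"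
      by (simp add: power2_eq_square algebra_simps)
    also have "\<dots> = \<theta> * s * exp (\<theta> * b j) * \<beta> j * (w i j * \<alpha> i)"
      using ij by (simp add: cross)
    finally show "(w i j)\<^sup>2 * (exp (\<theta> * b j) - exp (\<theta> * a i)) \<le>
        \<theta> * s * exp (\<theta> * b j) * \<beta> j * (w i j * \<alpha> i)" .
  qed
  also have "\<dots> = (\<Sum>j<n. \<theta> * s * exp (\<theta> * b j) * \<beta> j * \<beta> j)"
    by (subst sum.swap) (simp add: w_\<alpha> flip: sum_distrib_left)
  also have "\<dots> = \<theta> * s * exp_form \<theta> M' q"
    unfolding H by (simp add: sum_distrib_left power2_eq_square mult.assoc)
  finally show ?trace .

  \<comment> \<open>Only one of the two factors of each square is expanded through the overlaps, so
    that \<open>w i j\<close> enters linearly and \<open>cross\<close> can remove it.\<close>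
  have "exp_form \<theta> M' q = (\<Sum>i<n. \<Sum>j<n. exp (\<theta> * b j) * \<beta> j * (w i j * \<alpha> i))"
    unfolding H by (subst sum.swap) (simp add: w_\<alpha> power2_eq_square mult.assoc flip: sum_distrib_left)
  moreover have "exp_form \<theta> M q = (\<Sum>i<n. \<Sum>j<n. exp (\<theta> * a i) * \<alpha> i * (w i j * \<beta> j))"
    unfolding H by (simp add: w_\<beta> power2_eq_square mult.assoc flip: sum_distrib_left)
  ultimately have "\<theta> * (exp_form \<theta> M' q - exp_form \<theta> M q) =
      (\<Sum>i<n. \<Sum>j<n. \<theta> * (w i j * \<alpha> i * \<beta> j * (exp (\<theta> * b j) - exp (\<theta> * a i))))"
    by (simp add: sum_subtractf sum_distrib_left algebra_simps)
  also have "\<dots> \<le> (\<Sum>i<n. \<Sum>j<n. \<theta>\<^sup>2 * s / 2 * ((\<alpha> i)\<^sup>2 * (\<beta> j)\<^sup>2 * (exp (\<theta> * a i) + exp (\<theta> * b j))))"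
  proof (intro sum_mono)
    fix i j assume ij: "i \<in> {..<n}" "j \<in> {..<n}"
    show "\<theta> * (w i j * \<alpha> i * \<beta> j * (exp (\<theta> * b j) - exp (\<theta> * a i))) \<le>
        \<theta>\<^sup>2 * s / 2 * ((\<alpha> i)\<^sup>2 * (\<beta> j)\<^sup>2 * (exp (\<theta> * a i) + exp (\<theta> * b j)))"
    proof (cases "\<theta> = 0 \<or> b j = a i")
      case True
      then show ?thesis using s by auto
    next
      case False
      define d where "d = \<theta> * b j - \<theta> * a i"
      have d0: "d \<noteq> 0" using False by (auto simp: d_def)
      \<comment> \<open>\<open>cross\<close> solved for the overlap: each summand becomes
        nonnegative weights times a divided difference of exp, which is symmetric in its two points;
        the sign of \<open>d\<close> thus does not affect the bound.\<close>
      have w: "\<theta> * w i j = \<theta>\<^sup>2 * s * \<alpha> i * \<beta> j / d"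
        using cross[of i j] ij False
        by (auto simp: d_def field_simps power2_eq_square)
      have "(exp (\<theta> * b j) - exp (\<theta> * a i)) / d \<le> (exp (\<theta> * a i) + exp (\<theta> * b j)) / 2"
      proof (cases "d > 0")
        case True
        then show ?thesis using exp_diff_le_trapezoid[of "\<theta> * a i" "\<theta> * b j"]
          by (simp add: d_def pos_divide_le_eq algebra_simps)
      next
        case False
        then have "d < 0" using d0 by simp
        then show ?thesis using exp_diff_le_trapezoid[of "\<theta> * b j" "\<theta> * a i"]
          by (simp add: d_def neg_divide_le_eq algebra_simps)
      qed
      then have "\<theta>\<^sup>2 * s * (\<alpha> i)\<^sup>2 * (\<beta> j)\<^sup>2 * ((exp (\<theta> * b j) - exp (\<theta> * a i)) / d) \<le>
          \<theta>\<^sup>2 * s * (\<alpha> i)\<^sup>2 * (\<beta> j)\<^sup>2 * ((exp (\<theta> * a i) + exp (\<theta> * b j)) / 2)"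
        using s by (intro mult_left_mono) auto
      moreover have "\<theta> * (w i j * \<alpha> i * \<beta> j * (exp (\<theta> * b j) - exp (\<theta> * a i))) =
          \<theta>\<^sup>2 * s * (\<alpha> i)\<^sup>2 * (\<beta> j)\<^sup>2 * ((exp (\<theta> * b j) - exp (\<theta> * a i)) / d)"
        unfolding mult.assoc[symmetric] w by (simp add: power2_eq_square)
      moreover have "\<theta>\<^sup>2 * s * (\<alpha> i)\<^sup>2 * (\<beta> j)\<^sup>2 * ((exp (\<theta> * a i) + exp (\<theta> * b j)) / 2) =
          \<theta>\<^sup>2 * s / 2 * ((\<alpha> i)\<^sup>2 * (\<beta> j)\<^sup>2 * (exp (\<theta> * a i) + exp (\<theta> * b j)))"
        by simp
      ultimately show ?thesis by (simp only:)
    qed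
  qed
  \<comment> \<open>Both double sums factor, and in each of them one factor is the squared norm of
    \<open>q\<close>, bounded by \<kappa> at the end.\<close>
  also have "\<dots> = \<theta>\<^sup>2 * s / 2 * ((\<Sum>i<n. \<Sum>j<n. (\<alpha> i)\<^sup>2 * (\<beta> j)\<^sup>2 * exp (\<theta> * a i)) +
      (\<Sum>i<n. \<Sum>j<n. (\<alpha> i)\<^sup>2 * (\<beta> j)\<^sup>2 * exp (\<theta> * b j)))"
    by (simp add: sum_distrib_left sum.distrib distrib_left)
  also have "(\<Sum>i<n. \<Sum>j<n. (\<alpha> i)\<^sup>2 * (\<beta> j)\<^sup>2 * exp (\<theta> * a i)) = (q \<bullet> q) * exp_form \<theta> M q"
    unfolding H \<beta>2[symmetric] sum_product by (subst sum.swap) (simp add: mult_ac)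
  also have "(\<Sum>i<n. \<Sum>j<n. (\<alpha> i)\<^sup>2 * (\<beta> j)\<^sup>2 * exp (\<theta> * b j)) = (q \<bullet> q) * exp_form \<theta> M' q"
    unfolding H \<alpha>2[symmetric] sum_product by (simp add: mult_ac)
  also have "\<theta>\<^sup>2 * s / 2 * ((q \<bullet> q) * exp_form \<theta> M q + (q \<bullet> q) * exp_form \<theta> M' q) =
      (q \<bullet> q) * (\<theta>\<^sup>2 * s / 2 * (exp_form \<theta> M q + exp_form \<theta> M' q))"
    by (simp add: algebra_simps)
  also have "\<dots> \<le> \<kappa> * (\<theta>\<^sup>2 * s / 2 * (exp_form \<theta> M q + exp_form \<theta> M' q))"
    using s \<kappa> unfolding H by (intro mult_right_mono mult_nonneg_nonneg add_nonneg_nonneg sum_nonneg) auto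
  finally show ?form by (simp add: mult_ac)
qed

text \<open>This inequality replaces the Golden--Thompson inequality. Along \<open>M + t q q\<^sup>T\<close>, the derivative of
  \<open>exp_trace \<theta>\<close> is \<open>\<theta> exp_form \<theta>\<close> and the derivative of \<open>exp_form \<theta>\<close> lies between \<open>0\<close>
  and \<open>\<theta> \<kappa> exp_form \<theta>\<close>; the proof integrates this with an equidistant subdivision.\<close>

lemma exp_trace_add_outer_le:
  assumes M: "M \<in> carrier_mat n n" "transpose_mat M = M" and q: "q \<in> carrier_vec n"
    and \<theta>: "\<theta> \<noteq> 0" and \<kappa>: "q \<bullet> q \<le> \<kappa>" "\<kappa> > 0"
  shows "exp_trace \<theta> (M + outer q) \<le> exp_trace \<theta> M + (exp (\<theta> * \<kappa>) - 1) / \<kappa> * exp_form \<theta> M q"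
proof -
  define x where "x = \<theta> * \<kappa>"
  have x0: "x \<noteq> 0" using \<theta> \<kappa> by (simp add: x_def)
  \<comment> \<open>Growth factor of the implicit trapezoidal rule with \<open>N\<close> steps for
    the equation y' = x y on the unit interval; its \<open>N\<close>-th power tends to
    \<open>exp x\<close>.\<close>
  define \<rho> where "\<rho> N = (1 + x / (2 * real N)) / (1 - x / (2 * real N))" for N :: nat
  define H where "H = exp_form \<theta> M q"
  define R where "R N = exp_trace \<theta> M + (1 + x / (2 * real N)) / \<kappa> * (\<rho> N ^ N - 1) * H" for N
  \<comment> \<open>Requiring \<open>N\<close> above the absolute value of \<open>x\<close> keeps
    numerator and denominator of \<open>\<rho> N\<close> positive.\<close>
  have bound: "exp_trace \<theta> (M + outer q) \<le> R N" if N: "real N > \<bar>x\<bar>" for N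
  proof -
    have Npos: "real N > 0" using N by simp
    define \<delta> where "\<delta> = x / real N"
    have \<delta>: "\<bar>\<delta>\<bar> < 1" "\<delta> \<noteq> 0" using N x0 Npos by (auto simp: \<delta>_def abs_divide)
    have \<rho>: "\<rho> N = (1 + \<delta> / 2) / (1 - \<delta> / 2)" by (simp add: \<rho>_def \<delta>_def mult.commute)
    have \<rho>pos: "\<rho> N > 0" using \<delta> unfolding \<rho> by (intro divide_pos_pos) auto
    define A where "A k = M + (real k / real N) \<cdot>\<^sub>m outer q" for k
    have A: "A k \<in> carrier_mat n n" "transpose_mat (A k) = A k" for k
      using M q symmetric_add_outer[OF M q] by (auto simp: A_def)
    have A0: "A 0 = M" and AN: "A N = M + outer q"
      using M q Npos by (auto simp: A_def intro!: eq_matI)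
    have ASuc: "A (Suc k) = A k + (1 / real N) \<cdot>\<^sub>m outer q" for k
      using M q by (auto simp: A_def add_divide_distrib algebra_simps intro!: eq_matI)
    define h where "h k = exp_form \<theta> (A k) q" for k
    \<comment> \<open>Solve the implicit step for the new value. The factor \<theta> stays on both
      sides, since for negative \<theta> the bound on \<open>h\<close> itself points the other
      way.\<close>
    have step: "\<theta> * h (Suc k) \<le> \<rho> N * (\<theta> * h k)" for k
    proof -
      have "\<theta> * (h (Suc k) - h k) \<le> \<theta>\<^sup>2 * (1 / real N) * \<kappa> * (h k + h (Suc k)) / 2"
        unfolding h_def ASuc by (rule rank_one_step(2)[OF A q _ \<kappa>(1)]) simp
      also have "\<dots> = \<theta> * \<delta> * (h k + h (Suc k)) / 2"
        by (simp add: \<delta>_def x_def power2_eq_square)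
      finally have "(1 - \<delta> / 2) * (\<theta> * h (Suc k)) \<le> (1 + \<delta> / 2) * (\<theta> * h k)"
        by (simp add: algebra_simps)
      moreover have "1 - \<delta> / 2 > 0" using \<delta> by auto
      ultimately show ?thesis by (simp add: \<rho> field_simps)
    qed
    have pow: "\<theta> * h k \<le> \<rho> N ^ k * (\<theta> * H)" for k
    proof (induction k)
      case 0
      then show ?case by (simp add: h_def A0 H_def)
    next
      case (Suc k)
      have "\<theta> * h (Suc k) \<le> \<rho> N * (\<theta> * h k)" by (rule step)
      also have "\<dots> \<le> \<rho> N * (\<rho> N ^ k * (\<theta> * H))" using Suc \<rho>pos by (intro mult_left_mono) auto
      finally show ?case by (simp add: mult.assoc)
    qed
    have "exp_trace \<theta> (A k) \<le> exp_trace \<theta> M + (\<Sum>i<k. \<rho> N ^ Suc i * (\<theta> * H) / real N)" for k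
    proof (induction k)
      case 0
      then show ?case by (simp add: A0)
    next
      case (Suc k)
      have "exp_trace \<theta> (A (Suc k)) - exp_trace \<theta> (A k) \<le> \<theta> * (1 / real N) * h (Suc k)"
        unfolding h_def ASuc by (rule rank_one_step(1)[OF A q _ \<kappa>(1)]) simp
      also have "\<dots> \<le> \<rho> N ^ Suc k * (\<theta> * H) / real N"
        using divide_right_mono[OF pow[of "Suc k"], of "real N"] Npos by simp
      finally show ?case using Suc by simp
    qed
    from this[of N] have "exp_trace \<theta> (M + outer q) \<le>
        exp_trace \<theta> M + (\<Sum>i<N. \<rho> N ^ Suc i * (\<theta> * H) / real N)" by (simp add: AN)
    \<comment> \<open>The step bounds form a geometric series; its closed form is needed because the
      limit is taken in \<open>R N\<close>.\<close>
    also have "(\<Sum>i<N. \<rho> N ^ Suc i * (\<theta> * H) / real N) = (\<Sum>i<N. \<rho> N ^ i) * (\<rho> N * (\<theta> * H) / real N)"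
      by (simp add: sum_distrib_left sum_distrib_right sum_divide_distrib mult_ac)
    also have "(\<Sum>i<N. \<rho> N ^ i) = (\<rho> N ^ N - 1) / (\<rho> N - 1)"
      using \<delta> by (intro geometric_sum) (auto simp: \<rho> field_simps)
    also have "\<rho> N - 1 = \<delta> / (1 - \<delta> / 2)"
      using \<delta> by (auto simp: \<rho> field_simps)
    also have "(\<rho> N ^ N - 1) / (\<delta> / (1 - \<delta> / 2)) * (\<rho> N * (\<theta> * H) / real N) =
        (\<rho> N * (1 - \<delta> / 2)) * (\<theta> / (\<delta> * real N)) * (\<rho> N ^ N - 1) * H"
      using \<delta> by (simp add: divide_simps)
    also have "\<rho> N * (1 - \<delta> / 2) = 1 + x / (2 * real N)"
      using \<delta> by (auto simp: \<rho>) (simp add: \<delta>_def mult.commute)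
    also have "\<theta> / (\<delta> * real N) = 1 / \<kappa>"
      using Npos \<theta> by (simp add: \<delta>_def x_def)
    finally show ?thesis by (simp add: R_def)
  qed
  have "(\<lambda>N. \<rho> N ^ N) \<longlonglongrightarrow> exp x"
    unfolding \<rho>_def by real_asymp
  moreover have "(\<lambda>N. 1 + x / (2 * real N)) \<longlonglongrightarrow> 1" by real_asymp
  ultimately have "R \<longlonglongrightarrow> exp_trace \<theta> M + 1 / \<kappa> * (exp x - 1) * H"
    unfolding R_def using \<kappa> by (intro tendsto_intros) auto
  moreover have "\<forall>\<^sub>F N in sequentially. exp_trace \<theta> (M + outer q) \<le> R N"
    using eventually_gt_at_top[of "nat \<lceil>\<bar>x\<bar>\<rceil>"]
    by eventually_elim (rule bound, linarith)
  ultimately have "exp_trace \<theta> (M + outer q) \<le> exp_trace \<theta> M + 1 / \<kappa> * (exp x - 1) * H"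
    by (intro tendsto_lowerbound) auto
  then show ?thesis by (simp add: H_def x_def)
qed

section \<open>Random sums from a tight frame\<close>

text \<open>The weighted sum of the outer squares of the \<open>p k\<close>. Real weights cover
  multiplicities of repeated draws and indicators of subsets alike.\<close>

definition gram :: "nat \<Rightarrow> nat \<Rightarrow> (nat \<Rightarrow> real vec) \<Rightarrow> (nat \<Rightarrow> real) \<Rightarrow> real mat" where
  "gram n m p w = mat n n (\<lambda>(i, j). \<Sum>k<m. w k * p k $ i * p k $ j)"

lemma gram_carrier [simp]: "gram n m p w \<in> carrier_mat n n"
  by (simp add: gram_def)

lemma gram_dim [simp]: "dim_row (gram n m p w) = n" "dim_col (gram n m p w) = n"
  by (simp_all add: gram_def)

lemma gram_symmetric [simp]: "transpose_mat (gram n m p w) = gram n m p w"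
  by (rule eq_matI) (auto simp: gram_def mult_ac)

lemma gram_cong: "(\<And>k. k < m \<Longrightarrow> w k = w' k) \<Longrightarrow> gram n m p w = gram n m p w'"
  by (simp add: gram_def)

lemma gram_add_outer:
  assumes "j < m" "p j \<in> carrier_vec n"
  shows "gram n m p (w(j := w j + 1)) = gram n m p w + outer (p j)"
proof (rule eq_matI)
  fix i l assume "i < dim_row (gram n m p w + outer (p j))" "l < dim_col (gram n m p w + outer (p j))"
  then have il: "i < n" "l < n" using assms by auto
  have "(\<Sum>k<m. (w(j := w j + 1)) k * p k $ i * p k $ l) =
      (\<Sum>k<m. w k * p k $ i * p k $ l + (if k = j then p j $ i * p j $ l else 0))"
    by (intro sum.cong) (auto simp: algebra_simps)
  also have "\<dots> = (\<Sum>k<m. w k * p k $ i * p k $ l) + p j $ i * p j $ l"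
    using assms by (simp add: sum.distrib)
  finally show "gram n m p (w(j := w j + 1)) $$ (i, l) = (gram n m p w + outer (p j)) $$ (i, l)"
    using il assms by (simp add: gram_def outer_def)
qed (use assms in auto)

lemma scalar_prod_gram:
  assumes "\<And>k. k < m \<Longrightarrow> p k \<in> carrier_vec n" "x \<in> carrier_vec n" "y \<in> carrier_vec n"
  shows "x \<bullet> (gram n m p w *\<^sub>v y) = (\<Sum>k<m. w k * (p k \<bullet> x) * (p k \<bullet> y))"
proof -
  have "x \<bullet> (gram n m p w *\<^sub>v y) =
      (\<Sum>i<n. \<Sum>j<n. \<Sum>k<m. x $ i * (w k * p k $ i * p k $ j) * y $ j)"
    using assms(2,3)
    by (simp add: scalar_prod_def gram_def lessThan_atLeast0[symmetric] sum_distrib_left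
        sum_distrib_right mult.assoc)
  also have "\<dots> = (\<Sum>k<m. \<Sum>i<n. \<Sum>j<n. x $ i * (w k * p k $ i * p k $ j) * y $ j)"
    by (subst (2) sum.swap, subst sum.swap) simp
  also have "\<dots> = (\<Sum>k<m. w k * (p k \<bullet> x) * (p k \<bullet> y))"
    using assms
    by (intro sum.cong refl)
      (simp add: scalar_prod_def lessThan_atLeast0[symmetric] sum_product sum_distrib_left mult_ac)
  finally show ?thesis .
qed

text \<open>Double counting of pairs of a set and one of its elements: a set of size
  \<open>Suc K\<close> arises from \<open>Suc K\<close> smaller ones. This plays the role of drawing
  one more row without replacement.\<close>

lemma sum_card_subsets_insert:
  fixes f :: "'a set \<Rightarrow> real"
  assumes "finite A"
  shows "real (Suc K) * (\<Sum>S\<in>{S. S \<subseteq> A \<and> card S = Suc K}. f S) =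
    (\<Sum>S\<in>{S. S \<subseteq> A \<and> card S = K}. \<Sum>j\<in>A - S. f (insert j S))"
proof -
  have fin: "finite {S. S \<subseteq> A \<and> card S = k}" for k using assms by simp
  have finS: "finite S" if "S \<subseteq> A" for S using that assms by (rule finite_subset)
  have "real (Suc K) * (\<Sum>S\<in>{S. S \<subseteq> A \<and> card S = Suc K}. f S) =
      (\<Sum>S\<in>{S. S \<subseteq> A \<and> card S = Suc K}. \<Sum>j\<in>S. f S)"
    by (simp add: sum_distrib_left)
  also have "\<dots> = (\<Sum>(S, j)\<in>(SIGMA S:{S. S \<subseteq> A \<and> card S = Suc K}. S). f S)"
    by (rule sum.Sigma) (auto simp: fin intro: finS)
  also have "\<dots> = (\<Sum>(S, j)\<in>(SIGMA S:{S. S \<subseteq> A \<and> card S = K}. A - S). f (insert j S))"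
    by (rule sum.reindex_bij_witness[where j = "\<lambda>(S, j). (S - {j}, j)" and i = "\<lambda>(S, j). (insert j S, j)"])
      (auto simp: insert_absorb finS)
  also have "\<dots> = (\<Sum>S\<in>{S. S \<subseteq> A \<and> card S = K}. \<Sum>j\<in>A - S. f (insert j S))"
    using assms by (intro sum.Sigma[symmetric]) (auto simp: fin)
  finally show ?thesis .
qed

lemma diff_mult_binomial:
  assumes "K \<le> m"
  shows "(real m - real K) * real (m choose K) = real (Suc K) * real (m choose Suc K)"
proof -
  have "Suc K * (m choose Suc K) = (m - K) * (m choose K)"
    by (simp only: binomial_absorb_comp binomial_absorption)
  from arg_cong[OF this, of real] show ?thesis using assms by (simp add: of_nat_diff algebra_simps)
qed

text \<open>By symmetry each element lies in the same proportion \<open>K / card A\<close> of the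
  subsets; the denominator is cleared.\<close>

lemma sum_card_subsets_sum:
  fixes a :: "'a \<Rightarrow> real"
  assumes A: "finite A" and "K \<le> card A"
  shows "real (card A) * (\<Sum>S\<in>{S. S \<subseteq> A \<and> card S = K}. sum a S) =
    real K * real (card A choose K) * sum a A"
  using assms(2)
proof (induction K)
  case 0
  have "{S. S \<subseteq> A \<and> card S = 0} = {{}}" using A finite_subset by fastforce
  then show ?case by simp
next
  case (Suc K)
  let ?m = "card A"
  let ?H = "\<lambda>K. \<Sum>S\<in>{S. S \<subseteq> A \<and> card S = K}. sum a S"
  have "real (Suc K) * ?H (Suc K) =
      (\<Sum>S\<in>{S. S \<subseteq> A \<and> card S = K}. \<Sum>j\<in>A - S. sum a (insert j S))"
    by (rule sum_card_subsets_insert[OF A])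
  \<comment> \<open>The \<open>- 1\<close> stems from the new elements, whose values add up to
    \<open>sum a A - sum a S\<close>.\<close>
  also have "\<dots> = (\<Sum>S\<in>{S. S \<subseteq> A \<and> card S = K}. (real ?m - real K - 1) * sum a S + sum a A)"
  proof (intro sum.cong refl)
    fix S assume S: "S \<in> {S. S \<subseteq> A \<and> card S = K}"
    then have fin: "finite S" using A finite_subset by auto
    have "(\<Sum>j\<in>A - S. sum a (insert j S)) = (\<Sum>j\<in>A - S. a j + sum a S)"
      using fin by (intro sum.cong) auto
    also have "\<dots> = sum a (A - S) + real (card (A - S)) * sum a S" by (simp add: sum.distrib)
    also have "sum a (A - S) = sum a A - sum a S" using S A by (intro sum_diff) auto
    also have "real (card (A - S)) = real ?m - real K"
      using S A fin card_mono[of A S] by (auto simp: card_Diff_subset of_nat_diff)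
    finally show "(\<Sum>j\<in>A - S. sum a (insert j S)) = (real ?m - real K - 1) * sum a S + sum a A"
      by (simp add: algebra_simps)
  qed
  also have "\<dots> = (real ?m - real K - 1) * ?H K + real (?m choose K) * sum a A"
    using n_subsets[OF A, of K] by (simp add: sum.distrib sum_distrib_left)
  finally have "real (Suc K) * (real ?m * ?H (Suc K)) =
      (real ?m - real K - 1) * (real ?m * ?H K) + real ?m * real (?m choose K) * sum a A"
    by (subst mult.left_commute) (simp only:, simp add: algebra_simps)
  also have "real ?m * ?H K = real K * real (?m choose K) * sum a A" using Suc by simp
  also have "(real ?m - real K - 1) * (real K * real (?m choose K) * sum a A) +
      real ?m * real (?m choose K) * sum a A =
      (real K + 1) * ((real ?m - real K) * real (?m choose K)) * sum a A"
    by (simp add: algebra_simps)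
  also have "(real ?m - real K) * real (?m choose K) = real (Suc K) * real (?m choose Suc K)"
    using Suc.prems by (intro diff_mult_binomial) simp
  finally show ?case by simp
qed

text \<open>\<open>tight\<close> says that the outer squares of the \<open>p k\<close> average to
  the identity over \<open>c\<close>. As \<theta> tends to minus infinity,
  \<open>growth \<theta>\<close> tends to \<open>- 1 / \<kappa>\<close>; \<open>c_\<kappa>\<close>
  keeps \<open>1 + growth \<theta> / c\<close> nonnegative even there, so it may multiply
  inequalities.\<close>

locale tight_frame =
  fixes n m :: nat and p :: "nat \<Rightarrow> real vec" and c \<kappa> :: real
  assumes vec: "k < m \<Longrightarrow> p k \<in> carrier_vec n"
    and tight: "x \<in> carrier_vec n \<Longrightarrow> (\<Sum>k<m. (p k \<bullet> x)\<^sup>2) = real m / c * (x \<bullet> x)"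
    and norm_le: "k < m \<Longrightarrow> p k \<bullet> p k \<le> \<kappa>"
    and pos: "c > 0" "\<kappa> > 0" and c_\<kappa>: "1 \<le> c * \<kappa>" and m_pos: "m > 0"
begin

abbreviation G :: "(nat \<Rightarrow> real) \<Rightarrow> real mat" where "G w \<equiv> gram n m p w"

section \<open>Spectral identities for weighted sums over a tight frame\<close>

lemma eigvec_G:
  assumes "i < n"
  shows "eigvec (G w) i \<in> carrier_vec n" "G w *\<^sub>v eigvec (G w) i = eigval (G w) i \<cdot>\<^sub>v eigvec (G w) i"
    "eigvec (G w) i \<bullet> eigvec (G w) i = 1"
  using eigensystem_eigvec_eigval[of "G w" n] assms by (auto simp: eigensystem_def)

lemma eigvec_comm: "i < n \<Longrightarrow> k < m \<Longrightarrow> eigvec (G w) i \<bullet> p k = p k \<bullet> eigvec (G w) i"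
  using eigvec_G vec by (intro comm_scalar_prod[of _ n]) auto

lemma eigval_G:
  assumes "i < n"
  shows "eigval (G w) i = (\<Sum>k<m. w k * (eigvec (G w) i \<bullet> p k)\<^sup>2)"
proof -
  note u = eigvec_G[OF assms, of w]
  have "eigval (G w) i = eigvec (G w) i \<bullet> (G w *\<^sub>v eigvec (G w) i)"
    using u by (simp add: scalar_prod_smult_distrib[of _ n])
  also have "\<dots> = (\<Sum>k<m. w k * (p k \<bullet> eigvec (G w) i) * (p k \<bullet> eigvec (G w) i))"
    by (rule scalar_prod_gram) (use vec u in auto)
  finally show ?thesis using assms by (simp add: power2_eq_square eigvec_comm mult.assoc)
qed

lemma sum_eigvec_sq:
  assumes "k < m"
  shows "(\<Sum>i<n. (eigvec (G w) i \<bullet> p k)\<^sup>2) = p k \<bullet> p k"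
  using eigensystem_parseval[OF eigensystem_eigvec_eigval[of "G w" n] vec vec, OF _ _ assms assms]
  by (simp add: power2_eq_square)

lemma sum_eigval: "(\<Sum>i<n. eigval (G w) i) = (\<Sum>k<m. w k * (p k \<bullet> p k))"
proof -
  have "(\<Sum>i<n. eigval (G w) i) = (\<Sum>i<n. \<Sum>k<m. w k * (eigvec (G w) i \<bullet> p k)\<^sup>2)"
    by (intro sum.cong) (auto simp: eigval_G)
  also have "\<dots> = (\<Sum>k<m. w k * (p k \<bullet> p k))"
    by (subst sum.swap) (simp add: sum_eigvec_sq flip: sum_distrib_left)
  finally show ?thesis .
qed

lemma tight_eigvec: "i < n \<Longrightarrow> (\<Sum>k<m. (eigvec (G w) i \<bullet> p k)\<^sup>2) = real m / c"
  using tight[OF eigvec_G(1), of i w] eigvec_G(3)[of i w] by (simp add: eigvec_comm)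

lemma sum_norms: "(\<Sum>k<m. p k \<bullet> p k) = real n * (real m / c)"
proof -
  \<comment> \<open>The eigenbasis of the zero matrix merely supplies some orthonormal
    basis.\<close>
  have "(\<Sum>k<m. p k \<bullet> p k) = (\<Sum>k<m. \<Sum>i<n. (eigvec (G (\<lambda>_. 0)) i \<bullet> p k)\<^sup>2)"
    by (intro sum.cong) (auto simp: sum_eigvec_sq)
  also have "\<dots> = real n * (real m / c)" by (subst sum.swap) (simp add: tight_eigvec)
  finally show ?thesis .
qed

text \<open>The trace of the exponential times the full frame operator, which is
  \<open>m / c\<close> times the identity.\<close>

lemma sum_exp_form: "(\<Sum>k<m. exp_form \<theta> (G w) (p k)) = real m / c * exp_trace \<theta> (G w)"
proof -
  have "(\<Sum>k<m. exp_form \<theta> (G w) (p k)) = (\<Sum>i<n. exp (\<theta> * eigval (G w) i) * (real m / c))"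
    unfolding exp_form_def by (subst sum.swap) (simp add: tight_eigvec flip: sum_distrib_left)
  then show ?thesis by (simp only: sum_distrib_right[symmetric]) (simp add: exp_trace_def)
qed

text \<open>The trace of the exponential times \<open>G w\<close> itself; for an indicator weight
  this is the share of the rows already drawn.\<close>

lemma sum_weighted_exp_form:
  "(\<Sum>k<m. w k * exp_form \<theta> (G w) (p k)) = (\<Sum>i<n. eigval (G w) i * exp (\<theta> * eigval (G w) i))"
proof -
  have "(\<Sum>k<m. w k * exp_form \<theta> (G w) (p k)) =
      (\<Sum>i<n. (\<Sum>k<m. w k * (eigvec (G w) i \<bullet> p k)\<^sup>2) * exp (\<theta> * eigval (G w) i))"
    unfolding exp_form_def sum_distrib_left sum_distrib_right
    by (subst sum.swap) (simp add: mult_ac)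
  then show ?thesis by (simp add: eigval_G[symmetric])
qed

lemma exp_trace_G_0: "exp_trace \<theta> (G (\<lambda>_. 0)) = real n"
  by (simp add: exp_trace_def eigval_G)

text \<open>The slope of the chord of \<open>exp (\<theta> * t)\<close> between \<open>t = 0\<close>
  and \<open>t = \<kappa>\<close>.\<close>

definition growth :: "real \<Rightarrow> real" where
  "growth \<theta> = (exp (\<theta> * \<kappa>) - 1) / \<kappa>"

lemma growth_pos_iff: "growth \<theta> > 0 \<longleftrightarrow> \<theta> > 0" "growth \<theta> < 0 \<longleftrightarrow> \<theta> < 0"
  using pos by (auto simp: growth_def zero_less_divide_iff divide_less_0_iff mult_less_0_iff
      zero_less_mult_iff)

lemma growth_factor_nonneg: "0 \<le> 1 + growth \<theta> / c"
proof -
  have "1 + growth \<theta> / c = ((c * \<kappa> - 1) + exp (\<theta> * \<kappa>)) / (c * \<kappa>)"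
    using pos by (simp add: growth_def field_simps)
  then show ?thesis using pos c_\<kappa> by (auto intro!: divide_nonneg_pos add_nonneg_nonneg)
qed

lemma exp_trace_G_upd_le:
  assumes "\<theta> \<noteq> 0" "j < m"
  shows "exp_trace \<theta> (G (w(j := w j + 1))) \<le> exp_trace \<theta> (G w) + growth \<theta> * exp_form \<theta> (G w) (p j)"
  unfolding gram_add_outer[of j m p n w, OF assms(2) vec[OF assms(2)]] growth_def
  by (rule exp_trace_add_outer_le) (use assms vec norm_le pos in auto)

text \<open>One draw with replacement: the update bound is linear in the quadratic form, whose sum
  over all rows is again a multiple of the trace.\<close>

lemma sum_exp_trace_upd_le:
  assumes "\<theta> \<noteq> 0"
  shows "(\<Sum>j<m. exp_trace \<theta> (G (w(j := w j + 1)))) \<le> real m * (1 + growth \<theta> / c) * exp_trace \<theta> (G w)"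
proof -
  have "(\<Sum>j<m. exp_trace \<theta> (G (w(j := w j + 1)))) \<le>
      (\<Sum>j<m. exp_trace \<theta> (G w) + growth \<theta> * exp_form \<theta> (G w) (p j))"
    by (intro sum_mono exp_trace_G_upd_le) (use assms in auto)
  also have "\<dots> = real m * (1 + growth \<theta> / c) * exp_trace \<theta> (G w)"
    by (simp add: sum.distrib sum_exp_form algebra_simps flip: sum_distrib_left)
  finally show ?thesis .
qed

definition subset_trace :: "real \<Rightarrow> nat set \<Rightarrow> real" where
  "subset_trace \<theta> S = exp_trace \<theta> (G (indicator S))"

text \<open>One draw without replacement: the forms of the rows outside \<open>S\<close> are the sum
  over all rows minus the share of \<open>S\<close>, and that share is the trace of the matrix times
  its exponential.\<close>

lemma sum_subset_trace_insert_le: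
  assumes "\<theta> \<noteq> 0" and S: "S \<subseteq> {..<m}"
  shows "(\<Sum>j\<in>{..<m} - S. subset_trace \<theta> (insert j S)) \<le>
    (real m - real (card S)) * subset_trace \<theta> S + growth \<theta> * (real m / c * subset_trace \<theta> S -
      (\<Sum>i<n. eigval (G (indicator S)) i * exp (\<theta> * eigval (G (indicator S)) i)))"
proof -
  let ?w = "indicator S :: nat \<Rightarrow> real"
  have fin: "finite S" using S finite_subset by auto
  have "(\<Sum>j\<in>{..<m} - S. subset_trace \<theta> (insert j S)) \<le>
      (\<Sum>j\<in>{..<m} - S. subset_trace \<theta> S + growth \<theta> * exp_form \<theta> (G ?w) (p j))"
  proof (rule sum_mono)
    fix j assume j: "j \<in> {..<m} - S"
    then have "indicator (insert j S) = ?w(j := ?w j + 1)" by (auto simp: indicator_def fun_eq_iff)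
    then show "subset_trace \<theta> (insert j S) \<le> subset_trace \<theta> S + growth \<theta> * exp_form \<theta> (G ?w) (p j)"
      using exp_trace_G_upd_le[OF assms(1), of j ?w] j by (simp add: subset_trace_def)
  qed
  also have "\<dots> = real (card ({..<m} - S)) * subset_trace \<theta> S +
      growth \<theta> * (\<Sum>j\<in>{..<m} - S. exp_form \<theta> (G ?w) (p j))"
    by (simp add: sum.distrib sum_distrib_left)
  also have "(\<Sum>j\<in>{..<m} - S. exp_form \<theta> (G ?w) (p j)) =
      (\<Sum>j<m. exp_form \<theta> (G ?w) (p j)) - (\<Sum>j\<in>S. exp_form \<theta> (G ?w) (p j))"
    using S by (intro sum_diff) auto
  also have "(\<Sum>j\<in>S. exp_form \<theta> (G ?w) (p j)) = (\<Sum>j<m. ?w j * exp_form \<theta> (G ?w) (p j))"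
    using S by (intro sum.mono_neutral_cong_left) auto
  also have "real (card ({..<m} - S)) = real m - real (card S)"
    using S fin card_mono[OF _ S] by (simp add: card_Diff_subset of_nat_diff)
  finally show ?thesis by (simp add: sum_exp_form sum_weighted_exp_form subset_trace_def)
qed

text \<open>Drawing without replacement, the mean of the next rank-one term given \<open>S\<close> is not a multiple of
  the identity but contains \<open>- G (indicator S)\<close>. Averaged over all \<open>S\<close> of size \<open>K\<close>, the eigenvalues
  have mean \<open>K / c\<close>, and the correlation inequality \<open>(\<lambda> - K/c) (e\<^bsup>\<theta>\<lambda>\<^esup> - e\<^bsup>\<theta>K/c\<^esup>) \<theta> \<ge> 0\<close>
  allows replacing them by that mean.\<close>

lemma sum_subset_trace_le:
  assumes \<theta>: "\<theta> \<noteq> 0" and "K \<le> m"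
  shows "(\<Sum>S\<in>{S. S \<subseteq> {..<m} \<and> card S = K}. subset_trace \<theta> S) \<le>
    real (m choose K) * real n * (1 + growth \<theta> / c) ^ K"
  using assms(2)
proof (induction K)
  case 0
  have "{S. S \<subseteq> {..<m} \<and> card S = 0} = {{}}" using finite_subset by fastforce
  moreover have "(indicator {} :: nat \<Rightarrow> real) = (\<lambda>_. 0)" by auto
  ultimately show ?case by (simp add: subset_trace_def exp_trace_G_0)
next
  case (Suc K)
  let ?F = "\<lambda>K. {S. S \<subseteq> {..<m} \<and> card S = K}"
  let ?g = "growth \<theta>"
  define a where "a = real K / c"
  define l where "l S i = eigval (G (indicator S)) i" for S :: "nat set" and i
  define D where "D S = (\<Sum>i<n. l S i * exp (\<theta> * l S i))" for S
  have T: "subset_trace \<theta> S = (\<Sum>i<n. exp (\<theta> * l S i))" for S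
    by (simp add: subset_trace_def exp_trace_def l_def)
  \<comment> \<open>\<open>x - a\<close> and \<open>exp (\<theta> * x) - exp (\<theta> * a)\<close>
    have equal signs for positive \<theta> and opposite ones for negative \<theta>; the factor
    \<open>?g\<close> changes sign accordingly.\<close>
  have corr: "?g * exp (\<theta> * a) * (x - a) \<le> ?g * (x * exp (\<theta> * x) - a * exp (\<theta> * x))" for x
  proof -
    have "0 \<le> ?g * ((x - a) * (exp (\<theta> * x) - exp (\<theta> * a)))"
    proof (cases "\<theta> > 0")
      case True
      then have "0 \<le> (x - a) * (exp (\<theta> * x) - exp (\<theta> * a))"
        by (cases "x \<ge> a") (auto intro!: mult_nonpos_nonpos)
      then show ?thesis using growth_pos_iff(1)[of \<theta>] True by simp
    next
      case False
      then have "\<theta> < 0" using \<theta> by simp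
      then have "(x - a) * (exp (\<theta> * x) - exp (\<theta> * a)) \<le> 0"
        by (cases "x \<ge> a") (auto simp: mult_le_0_iff)
      then show ?thesis using growth_pos_iff(2)[of \<theta>] \<open>\<theta> < 0\<close> by (intro mult_nonpos_nonpos) auto
    qed
    then show ?thesis by (simp add: algebra_simps)
  qed
  have "(\<Sum>S\<in>?F K. \<Sum>i<n. l S i) = (\<Sum>S\<in>?F K. \<Sum>k\<in>S. p k \<bullet> p k)"
  proof (rule sum.cong[OF refl])
    fix S assume "S \<in> ?F K"
    then show "(\<Sum>i<n. l S i) = (\<Sum>k\<in>S. p k \<bullet> p k)"
      unfolding l_def sum_eigval by (intro sum.mono_neutral_cong_right) auto
  qed
  moreover have "real m * (\<Sum>S\<in>?F K. \<Sum>k\<in>S. p k \<bullet> p k) =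
      real K * real (m choose K) * (real n * (real m / c))"
    using sum_card_subsets_sum[of "{..<m}" K "\<lambda>k. p k \<bullet> p k"] Suc.prems by (simp add: sum_norms)
  ultimately have "real m * (\<Sum>S\<in>?F K. \<Sum>i<n. l S i) = real m * (a * real n * real (m choose K))"
    by (simp add: a_def mult_ac)
  then have mean: "(\<Sum>S\<in>?F K. \<Sum>i<n. l S i) = a * real n * real (m choose K)"
    using m_pos by simp
  have cardF: "card (?F K) = m choose K" using n_subsets[of "{..<m}" K] by simp
  \<comment> \<open>\<open>a\<close> is the mean of all eigenvalues over all subsets, so the linear
    side of \<open>corr\<close> cancels in the sum, although not for a single subset.\<close>
  have "0 = ?g * exp (\<theta> * a) * ((\<Sum>S\<in>?F K. \<Sum>i<n. l S i) - (\<Sum>S\<in>?F K. \<Sum>i<n. a))"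
    unfolding mean by (simp add: cardF)
  also have "\<dots> = (\<Sum>S\<in>?F K. \<Sum>i<n. ?g * exp (\<theta> * a) * (l S i - a))"
    by (simp only: sum_subtractf[symmetric] sum_distrib_left)
  also have "\<dots> \<le> (\<Sum>S\<in>?F K. \<Sum>i<n. ?g * (l S i * exp (\<theta> * l S i) - a * exp (\<theta> * l S i)))"
    by (intro sum_mono corr)
  also have "\<dots> = (\<Sum>S\<in>?F K. ?g * (D S - a * subset_trace \<theta> S))"
    by (simp only: sum_subtractf[symmetric] sum_distrib_left D_def T)
  finally have corr_sum: "0 \<le> (\<Sum>S\<in>?F K. ?g * (D S - a * subset_trace \<theta> S))" .
  have "real (Suc K) * (\<Sum>S\<in>?F (Suc K). subset_trace \<theta> S) =
      (\<Sum>S\<in>?F K. \<Sum>j\<in>{..<m} - S. subset_trace \<theta> (insert j S))"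
    by (rule sum_card_subsets_insert) simp
  also have "\<dots> \<le> (\<Sum>S\<in>?F K. (real m - real K) * subset_trace \<theta> S +
      ?g * (real m / c * subset_trace \<theta> S - D S))"
    using sum_subset_trace_insert_le[OF \<theta>] by (intro sum_mono) (auto simp: D_def l_def)
  \<comment> \<open>Split \<open>m / c\<close> into \<open>(m - K) / c\<close> and
    \<open>a = K / c\<close>: the first part produces the growth factor, the second pairs with
    \<open>D S\<close> in the correlation term.\<close>
  also have "\<dots> = (\<Sum>S\<in>?F K. (real m - real K) * (1 + ?g / c) * subset_trace \<theta> S -
      ?g * (D S - a * subset_trace \<theta> S))"
    using pos by (intro sum.cong refl) (simp add: a_def field_simps)
  also have "\<dots> \<le> (real m - real K) * (1 + ?g / c) * (\<Sum>S\<in>?F K. subset_trace \<theta> S)"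
    using corr_sum by (simp add: sum_subtractf sum_distrib_left)
  also have "\<dots> \<le> (real m - real K) * (1 + ?g / c) * (real (m choose K) * real n * (1 + ?g / c) ^ K)"
    using Suc growth_factor_nonneg[of \<theta>] by (intro mult_left_mono mult_nonneg_nonneg) auto
  also have "\<dots> = (real m - real K) * real (m choose K) * (real n * (1 + ?g / c) ^ Suc K)"
    by simp
  also have "(real m - real K) * real (m choose K) = real (Suc K) * real (m choose Suc K)"
    using Suc.prems by (intro diff_mult_binomial) simp
  finally have "real (Suc K) * (\<Sum>S\<in>?F (Suc K). subset_trace \<theta> S) \<le>
      real (Suc K) * (real (m choose Suc K) * real n * (1 + ?g / c) ^ Suc K)"
    by (simp add: mult.assoc)
  then show ?case by (rule mult_left_le_imp_le) simp
qed

end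

section \<open>The sampling distributions\<close>

lemma sum_list_eq_sum_count:
  fixes f :: "'a \<Rightarrow> real"
  assumes "finite A" "set xs \<subseteq> A"
  shows "(\<Sum>x\<leftarrow>xs. f x) = (\<Sum>x\<in>A. real (count_list xs x) * f x)"
  using assms(2)
proof (induction xs)
  case (Cons y xs)
  have "(\<Sum>x\<in>A. real (count_list (y # xs) x) * f x) =
      (\<Sum>x\<in>A. real (count_list xs x) * f x + (if x = y then f y else 0))"
    by (intro sum.cong) (auto simp: algebra_simps)
  then show ?case using Cons assms(1) by (simp add: sum.distrib)
qed simp

lemma count_list_distinct: "distinct xs \<Longrightarrow> count_list xs x = (if x \<in> set xs then 1 else 0)"
  by (induction xs) auto

section \<open>Gram matrices of the sampled matrices\<close>

lemma transpose_mult_self_index: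
  fixes Z :: "real mat"
  assumes "Z \<in> carrier_mat d n" "i < n" "j < n"
  shows "(transpose_mat Z * Z) $$ (i, j) = (\<Sum>l<d. Z $$ (l, i) * Z $$ (l, j))"
  using assms by (simp add: scalar_prod_def lessThan_atLeast0)

definition scaled_row :: "nat \<Rightarrow> nat \<Rightarrow> real mat \<Rightarrow> nat \<Rightarrow> real vec" where
  "scaled_row m c Q k = sqrt (real m / real c) \<cdot>\<^sub>v row Q k"

text \<open>The order of the draws disappears in the Gram matrix; only multiplicities survive, as
  weights.\<close>

lemma sampling_matrix_gram:
  assumes Q: "Q \<in> carrier_mat m n" and ks: "set ks \<subseteq> {..<m}"
  shows "transpose_mat (sampling_matrix m c ks * Q) * (sampling_matrix m c ks * Q) =
    gram n m (scaled_row m c Q) (\<lambda>k. real (count_list ks k))"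
proof -
  let ?s = "sqrt (real m / real c)"
  let ?Z = "sampling_matrix m c ks * Q"
  have Z: "?Z \<in> carrier_mat (length ks) n" using Q by (auto simp: sampling_matrix_def)
  have Zl: "?Z $$ (l, i) = ?s * Q $$ (ks ! l, i)" if "l < length ks" "i < n" for l i
  proof -
    have kl: "ks ! l < m" using ks that nth_mem by blast
    have "mat_of_rows m (map (unit_vec m) ks) * Q \<in> carrier_mat (length ks) n" using Q by auto
    moreover have "sampling_matrix m c ks * Q = ?s \<cdot>\<^sub>m (mat_of_rows m (map (unit_vec m) ks) * Q)"
      unfolding sampling_matrix_def using Q
      by (intro mult_smult_assoc_mat[of _ "length ks" m _ n]) auto
    ultimately show ?thesis using Q that kl by (simp add: scalar_prod_left_unit)
  qed
  show ?thesis
  proof (rule eq_matI)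
    fix i j assume "i < dim_row (gram n m (scaled_row m c Q) (\<lambda>k. real (count_list ks k)))"
      "j < dim_col (gram n m (scaled_row m c Q) (\<lambda>k. real (count_list ks k)))"
    then have ij: "i < n" "j < n" by auto
    define f where "f k = scaled_row m c Q k $ i * scaled_row m c Q k $ j" for k
    have f: "f k = ?s * Q $$ (k, i) * (?s * Q $$ (k, j))" if "k < m" for k
      using that ij Q by (simp add: f_def scaled_row_def)
    have "(transpose_mat ?Z * ?Z) $$ (i, j) = (\<Sum>l<length ks. f (ks ! l))"
      unfolding transpose_mult_self_index[OF Z ij]
    proof (rule sum.cong[OF refl])
      fix l assume "l \<in> {..<length ks}"
      then have l: "l < length ks" by simp
      then have "ks ! l < m" using ks nth_mem by blast
      then show "?Z $$ (l, i) * ?Z $$ (l, j) = f (ks ! l)" using ij l by (simp only: Zl f)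
    qed
    also have "\<dots> = (\<Sum>k\<leftarrow>ks. f k)"
      by (simp add: sum_list_sum_nth lessThan_atLeast0)
    also have "\<dots> = (\<Sum>k<m. real (count_list ks k) * f k)"
      using ks by (intro sum_list_eq_sum_count) auto
    finally show "(transpose_mat ?Z * ?Z) $$ (i, j) =
        gram n m (scaled_row m c Q) (\<lambda>k. real (count_list ks k)) $$ (i, j)"
      using ij by (simp add: gram_def f_def mult.assoc)
  qed (use Z in auto)
qed

text \<open>Zero rows add nothing to a Gram matrix, so Bernoulli sampling fits the subset form in
  spite of its different matrix shape.\<close>

lemma diagonal_sampling_gram:
  assumes Q: "Q \<in> carrier_mat m n"
  shows "transpose_mat (mat_diag m (\<lambda>k. if k \<in> S then sqrt (real m / real c) else 0) * Q) *
      (mat_diag m (\<lambda>k. if k \<in> S then sqrt (real m / real c) else 0) * Q) =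
    gram n m (scaled_row m c Q) (indicator S)" (is "transpose_mat ?Z * ?Z = ?G")
proof -
  have Z: "?Z \<in> carrier_mat m n" using Q by (simp add: mat_diag_mult_left)
  show ?thesis
  proof (rule eq_matI)
    fix i j assume "i < dim_row ?G" "j < dim_col ?G"
    then have ij: "i < n" "j < n" by auto
    have "(transpose_mat ?Z * ?Z) $$ (i, j) =
        (\<Sum>k<m. indicator S k * scaled_row m c Q k $ i * scaled_row m c Q k $ j)"
      unfolding transpose_mult_self_index[OF Z ij]
      using Q ij by (intro sum.cong) (auto simp: mat_diag_mult_left[OF Q] scaled_row_def)
    then show "(transpose_mat ?Z * ?Z) $$ (i, j) = ?G $$ (i, j)" using ij by (simp add: gram_def)
  qed (use Z in auto)
qed

lemma tight_frame_scaled_row: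
  assumes Q: "Q \<in> carrier_mat m n" and orth: "transpose_mat Q * Q = 1\<^sub>m n"
    and n: "n \<ge> 1" and c: "c \<ge> 1" and m: "m \<ge> 1"
  shows "tight_frame n m (scaled_row m c Q) (real c) (real m * coherence Q / real c)"
    and "real m * coherence Q > 0"
proof -
  have row_norm: "row Q k \<bullet> row Q k \<le> coherence Q" if "k < m" for k
  proof -
    have "(vnorm2 (row Q k))\<^sup>2 \<le> coherence Q"
      unfolding coherence_def using that Q by (intro Max_ge) auto
    then show ?thesis by (simp add: vnorm2_def scalar_prod_self_nonneg)
  qed
  have parseval: "(\<Sum>k<m. (row Q k \<bullet> x)\<^sup>2) = x \<bullet> x" if x: "x \<in> carrier_vec n" for x
  proof -
    have "(\<Sum>k<m. (row Q k \<bullet> x)\<^sup>2) = (Q *\<^sub>v x) \<bullet> (Q *\<^sub>v x)"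
      using Q by (simp add: scalar_prod_def[of "Q *\<^sub>v x"] lessThan_atLeast0 power2_eq_square)
    also have "\<dots> = (transpose_mat Q *\<^sub>v (Q *\<^sub>v x)) \<bullet> x"
      using Q x by (intro transpose_vec_mult_scalar[symmetric, of Q m n]) auto
    also have "transpose_mat Q *\<^sub>v (Q *\<^sub>v x) = x"
      using assoc_mult_mat_vec[of "transpose_mat Q" n m Q n x] Q x orth by simp
    finally show ?thesis .
  qed
  \<comment> \<open>The first column of \<open>Q\<close> has norm one, and each of its squared
    entries is at most the squared norm of its row. The resulting
    \<open>1 \<le> m * coherence Q\<close> is the locale condition
    \<open>c_\<kappa>\<close>.\<close>
  have "1 = (\<Sum>k<m. (row Q k \<bullet> unit_vec n 0)\<^sup>2)"
    using parseval[of "unit_vec n 0"] n by simp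
  also have "\<dots> \<le> (\<Sum>k<m. coherence Q)"
  proof (rule sum_mono)
    fix k assume "k \<in> {..<m}"
    then have k: "k < m" by simp
    have "(row Q k \<bullet> unit_vec n 0)\<^sup>2 = row Q k $ 0 * row Q k $ 0"
      using Q n k by (simp add: power2_eq_square)
    also have "\<dots> \<le> (\<Sum>i\<in>{0..<n}. row Q k $ i * row Q k $ i)"
      using n by (intro member_le_sum) auto
    also have "\<dots> = row Q k \<bullet> row Q k" using Q k by (simp add: scalar_prod_def)
    finally show "(row Q k \<bullet> unit_vec n 0)\<^sup>2 \<le> coherence Q" using row_norm[OF k] by simp
  qed
  finally have ge1: "1 \<le> real m * coherence Q" by simp
  then show "real m * coherence Q > 0" by simp
  have s: "sqrt (real m / real c) * sqrt (real m / real c) = real m / real c" by simp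
  show "tight_frame n m (scaled_row m c Q) (real c) (real m * coherence Q / real c)"
  proof
    fix k assume k: "k < m"
    show "scaled_row m c Q k \<in> carrier_vec n" using Q k by (simp add: scaled_row_def)
    have "scaled_row m c Q k \<bullet> scaled_row m c Q k = real m / real c * (row Q k \<bullet> row Q k)"
      by (simp add: scaled_row_def mult.assoc[symmetric])
    then show "scaled_row m c Q k \<bullet> scaled_row m c Q k \<le> real m * coherence Q / real c"
      using row_norm[OF k] c by (simp add: divide_right_mono mult_left_mono)
  next
    fix x :: "real vec" assume x: "x \<in> carrier_vec n"
    have "(\<Sum>k<m. (scaled_row m c Q k \<bullet> x)\<^sup>2) = (\<Sum>k<m. real m / real c * (row Q k \<bullet> x)\<^sup>2)"
      using Q x by (intro sum.cong) (auto simp: scaled_row_def power_mult_distrib)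
    then show "(\<Sum>k<m. (scaled_row m c Q k \<bullet> x)\<^sup>2) = real m / real c * (x \<bullet> x)"
      by (simp only: sum_distrib_left[symmetric] parseval[OF x])
  qed (use c m ge1 in auto)
qed

text \<open>Cutting a permutation after \<open>card S\<close> entries is a bijection onto pairs of a
  permutation of \<open>S\<close> and one of its complement.\<close>

lemma card_permutations_take:
  assumes A: "finite A" and S: "S \<subseteq> A"
  shows "card {ks \<in> permutations_of_set A. set (take (card S) ks) = S} =
    fact (card S) * fact (card A - card S)"
proof -
  let ?P = "{ks \<in> permutations_of_set A. set (take (card S) ks) = S}"
  let ?Q = "permutations_of_set S \<times> permutations_of_set (A - S)"
  have fin: "finite S" "finite (A - S)" using A S finite_subset by auto
  have len: "length xs = card S" if "xs \<in> permutations_of_set S" for xs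
    using that by (rule length_finite_permutations_of_set)
  have "bij_betw (\<lambda>(xs, ys). xs @ ys) ?Q ?P"
  proof (rule bij_betw_byWitness[where f' = "\<lambda>ks. (take (card S) ks, drop (card S) ks)"])
    show "(\<lambda>(xs, ys). xs @ ys) ` ?Q \<subseteq> ?P"
      using S len by (auto simp: permutations_of_set_def)
    show "(\<lambda>ks. (take (card S) ks, drop (card S) ks)) ` ?P \<subseteq> ?Q"
    proof (rule image_subsetI)
      fix ks assume "ks \<in> ?P"
      then have ks: "ks \<in> permutations_of_set A" and eq: "S = set (take (card S) ks)" by auto
      define xs ys where "xs = take (card S) ks" and "ys = drop (card S) ks"
      have "ks = xs @ ys" by (simp add: xs_def ys_def)
      moreover have "set xs = S" using eq by (simp add: xs_def)
      ultimately have "xs \<in> permutations_of_set S" "ys \<in> permutations_of_set (A - S)"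
        using ks by (auto simp: permutations_of_set_def)
      then show "(take (card S) ks, drop (card S) ks) \<in> ?Q" by (simp add: xs_def ys_def)
    qed
  qed (auto simp: len)
  then have "card ?P = card ?Q" by (simp add: bij_betw_same_card)
  then show ?thesis using fin card_Diff_subset[OF fin(1) S] by (simp add: card_cartesian_product)
qed

text \<open>All fibres of the map to the set of the first \<open>K\<close> entries have equal size,
  so this set is a uniformly random \<open>K\<close>-subset.\<close>

lemma expectation_permutation_take:
  fixes f :: "'a set \<Rightarrow> real"
  assumes A: "finite A" and K: "K \<le> card A"
  shows "measure_pmf.expectation (pmf_of_set (permutations_of_set A)) (\<lambda>ks. f (set (take K ks))) =
    (\<Sum>S\<in>{S. S \<subseteq> A \<and> card S = K}. f S) / real (card A choose K)"
proof -
  let ?P = "permutations_of_set A"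
  let ?F = "{S. S \<subseteq> A \<and> card S = K}"
  have img: "(\<lambda>ks. set (take K ks)) ` ?P \<subseteq> ?F"
  proof safe
    fix ks assume ks: "ks \<in> ?P"
    then show "\<And>x. x \<in> set (take K ks) \<Longrightarrow> x \<in> A"
      by (auto simp: permutations_of_set_def dest: in_set_takeD)
    show "card (set (take K ks)) = K"
      using ks K length_finite_permutations_of_set[OF ks]
      by (subst distinct_card) (auto simp: permutations_of_set_def)
  qed
  have "(\<Sum>ks\<in>?P. f (set (take K ks))) =
      (\<Sum>S\<in>?F. \<Sum>ks\<in>{ks \<in> ?P. set (take K ks) = S}. f (set (take K ks)))"
    using A img by (intro sum.group[symmetric]) auto
  also have "\<dots> = (\<Sum>S\<in>?F. fact K * fact (card A - K) * f S)"
    using card_permutations_take[OF A] by (intro sum.cong) auto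
  finally have "(\<Sum>ks\<in>?P. f (set (take K ks))) = fact K * fact (card A - K) * (\<Sum>S\<in>?F. f S)"
    by (simp add: sum_distrib_left)
  moreover have "real (card A choose K) = fact (card A) / (fact K * fact (card A - K))"
    by (rule binomial_fact[OF K])
  ultimately show ?thesis using A by (simp add: integral_pmf_of_set)
qed

lemma pmf_Pi_bernoulli:
  assumes A: "finite A" and q: "0 \<le> q" "q \<le> 1" and S: "S \<subseteq> A"
  shows "pmf (Pi_pmf A False (\<lambda>_. bernoulli_pmf q)) (\<lambda>k. k \<in> S) =
    q ^ card S * (1 - q) ^ (card A - card S)"
proof -
  have fin: "finite S" using A S finite_subset by auto
  have "pmf (Pi_pmf A False (\<lambda>_. bernoulli_pmf q)) (\<lambda>k. k \<in> S) =
      (\<Prod>k\<in>A. pmf (bernoulli_pmf q) (k \<in> S))"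
    using S by (intro pmf_Pi'[OF A]) auto
  also have "\<dots> = (\<Prod>k\<in>A. if k \<in> S then q else 1 - q)"
    using q by (intro prod.cong) auto
  also have "\<dots> = q ^ card S * (1 - q) ^ card (A - S)"
    using S by (simp add: prod.If_cases[OF A] Int_absorb1 Diff_eq)
  finally show ?thesis by (simp add: card_Diff_subset[OF fin S])
qed

text \<open>The probability of a subset depends on its size only; grouping by size leaves the sums
  already bounded for sampling without replacement.\<close>

lemma expectation_Pi_bernoulli:
  fixes f :: "'a set \<Rightarrow> real"
  assumes A: "finite A" and q: "0 \<le> q" "q \<le> 1"
  shows "measure_pmf.expectation (Pi_pmf A False (\<lambda>_. bernoulli_pmf q)) (\<lambda>b. f {k. b k}) =
    (\<Sum>K\<le>card A. q ^ K * (1 - q) ^ (card A - K) * (\<Sum>S\<in>{S. S \<subseteq> A \<and> card S = K}. f S))"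
proof -
  let ?p = "Pi_pmf A False (\<lambda>_. bernoulli_pmf q)"
  let ?B = "(\<lambda>S k. k \<in> S) ` Pow A"
  have "measure_pmf.expectation ?p (\<lambda>b. f {k. b k}) = (\<Sum>b\<in>?B. f {k. b k} * pmf ?p b)"
  proof (rule integral_measure_pmf_real)
    fix b assume "b \<in> set_pmf ?p"
    \<comment> \<open>The default \<open>False\<close> outside \<open>A\<close> makes
      \<open>b\<close> the membership predicate of a subset of \<open>A\<close>.\<close>
    then have "\<forall>x. x \<notin> A \<longrightarrow> b x = False" using set_Pi_pmf_subset[OF A, of False "\<lambda>_. bernoulli_pmf q"] by blast
    then show "b \<in> ?B" by (intro image_eqI[of _ _ "{k. b k}"]) auto
  qed (use A in simp)
  also have "\<dots> = (\<Sum>S\<in>Pow A. f S * pmf ?p (\<lambda>k. k \<in> S))"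
    by (subst sum.reindex) (auto simp: inj_on_def fun_eq_iff set_eq_iff)
  also have "\<dots> = (\<Sum>S\<in>Pow A. q ^ card S * (1 - q) ^ (card A - card S) * f S)"
    by (intro sum.cong) (auto simp: pmf_Pi_bernoulli[OF A q])
  also have "\<dots> = (\<Sum>K\<le>card A. \<Sum>S\<in>{S \<in> Pow A. card S = K}. q ^ card S * (1 - q) ^ (card A - card S) * f S)"
    using A by (intro sum.group[symmetric]) (auto intro: card_mono)
  also have "\<dots> = (\<Sum>K\<le>card A. q ^ K * (1 - q) ^ (card A - K) * (\<Sum>S\<in>{S. S \<subseteq> A \<and> card S = K}. f S))"
    unfolding sum_distrib_left by (intro sum.cong) auto
  finally show ?thesis .
qed

lemma finite_set_replicate_pmf:
  assumes "finite (set_pmf p)"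
  shows "finite (set_pmf (replicate_pmf K p))"
proof (rule finite_subset)
  show "set_pmf (replicate_pmf K p) \<subseteq> {xs. set xs \<subseteq> set_pmf p \<and> length xs = K}"
    by (auto simp: set_replicate_pmf lists_eq_set)
qed (use assms in \<open>simp add: finite_lists_length_eq\<close>)

lemma one_plus_power_le_exp:
  fixes x :: real
  assumes "0 \<le> 1 + x / real k" "k \<ge> 1"
  shows "(1 + x / real k) ^ k \<le> exp x"
proof -
  have "(1 + x / real k) ^ k \<le> exp (x / real k) ^ k"
    using assms by (intro power_mono exp_ge_add_one_self) auto
  also have "\<dots> = exp x" using assms(2) by (simp flip: exp_of_nat_mult)
  finally show ?thesis .
qed

section \<open>The expected exponential trace under the three sampling methods\<close>

context
  fixes m n c :: nat and Q :: "real mat" and \<kappa> :: real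
  assumes Q: "Q \<in> carrier_mat m n" and frame: "tight_frame n m (scaled_row m c Q) (real c) \<kappa>"
    and cm: "c \<le> m"
begin

interpretation tight_frame n m "scaled_row m c Q" "real c" \<kappa> by (rule frame)

lemma c_ge_1: "c \<ge> 1" using pos by simp

lemma expectation_replicate_le:
  assumes "\<theta> \<noteq> 0"
  shows "measure_pmf.expectation (replicate_pmf K (pmf_of_set {..<m}))
      (\<lambda>ks. exp_trace \<theta> (G (\<lambda>k. real (count_list ks k)))) \<le> real n * (1 + growth \<theta> / real c) ^ K"
proof (induction K)
  case 0
  show ?case by (simp add: exp_trace_G_0)
next
  case (Suc K)
  let ?u = "pmf_of_set {..<m}"
  let ?r = "replicate_pmf K ?u"
  let ?T = "\<lambda>ks. exp_trace \<theta> (G (\<lambda>k. real (count_list ks k)))"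
  have ne: "{..<m} \<noteq> {}" using m_pos by auto
  have finr: "finite (set_pmf ?r)" using ne by (intro finite_set_replicate_pmf) simp
  \<comment> \<open>Exchange the two independent draws so that \<open>xs\<close> is fixed while the
    new row is averaged.\<close>
  have eq: "replicate_pmf (Suc K) ?u = ?r \<bind> (\<lambda>xs. ?u \<bind> (\<lambda>x. return_pmf (x # xs)))"
    by (simp add: bind_commute_pmf[of ?u])
  have "measure_pmf.expectation (replicate_pmf (Suc K) ?u) ?T =
      (\<Sum>xs\<in>set_pmf ?r. pmf ?r xs * measure_pmf.expectation (?u \<bind> (\<lambda>x. return_pmf (x # xs))) ?T)"
    unfolding eq using finr ne by (subst pmf_expectation_bind[of "set_pmf ?r"])
      (auto simp: map_pmf_def[symmetric] set_map_pmf)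
  also have "\<dots> \<le> (\<Sum>xs\<in>set_pmf ?r. pmf ?r xs * ((1 + growth \<theta> / real c) * ?T xs))"
  proof (intro sum_mono mult_left_mono)
    fix xs
    have "measure_pmf.expectation (?u \<bind> (\<lambda>x. return_pmf (x # xs))) ?T = (\<Sum>j<m. ?T (j # xs)) / real m"
      using ne by (simp add: map_pmf_def[symmetric] integral_pmf_of_set)
    also have "(\<Sum>j<m. ?T (j # xs)) =
        (\<Sum>j<m. exp_trace \<theta> (G ((\<lambda>k. real (count_list xs k))(j := real (count_list xs j) + 1))))"
      by (intro sum.cong refl arg_cong[of _ _ "exp_trace \<theta>"] gram_cong) auto
    also have "\<dots> \<le> real m * (1 + growth \<theta> / real c) * ?T xs"
      by (rule sum_exp_trace_upd_le[OF assms])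
    finally show "measure_pmf.expectation (?u \<bind> (\<lambda>x. return_pmf (x # xs))) ?T \<le>
        (1 + growth \<theta> / real c) * ?T xs"
      using m_pos by (simp add: divide_right_mono pos_divide_le_eq mult_ac)
  qed simp
  also have "\<dots> = (1 + growth \<theta> / real c) * measure_pmf.expectation ?r ?T"
    using finr by (subst integral_measure_pmf_real[of "set_pmf ?r"])
      (auto simp: sum_distrib_left mult_ac)
  also have "\<dots> \<le> (1 + growth \<theta> / real c) * (real n * (1 + growth \<theta> / real c) ^ K)"
    by (intro mult_left_mono Suc growth_factor_nonneg)
  finally show ?case by (simp add: mult_ac)
qed

text \<open>The three methods meet in one bound because both \<open>(1 + g / c) ^ c\<close> and
  \<open>(1 + g / m) ^ m\<close> are at most \<open>exp g\<close>.\<close>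

lemma expectation_exp_trace_le:
  assumes "\<S> \<in> {uniform_without_replacement m c, uniform_with_replacement m c,
      bernoulli_sampling m c}" and \<theta>: "\<theta> \<noteq> 0"
  shows "measure_pmf.expectation \<S> (\<lambda>S. exp_trace \<theta> (transpose_mat (S * Q) * (S * Q))) \<le>
    real n * exp (growth \<theta>)"
proof -
  let ?g = "growth \<theta>"
  have ne: "{..<m} \<noteq> {}" using m_pos by auto
  have power_c: "real n * (1 + ?g / real c) ^ c \<le> real n * exp ?g"
    by (intro mult_left_mono one_plus_power_le_exp growth_factor_nonneg c_ge_1) auto
  consider "\<S> = uniform_without_replacement m c" | "\<S> = uniform_with_replacement m c" |
    "\<S> = bernoulli_sampling m c" using assms by auto
  then show ?thesis
  proof cases
    case 1
    have "measure_pmf.expectation \<S> (\<lambda>S. exp_trace \<theta> (transpose_mat (S * Q) * (S * Q))) =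
        measure_pmf.expectation (pmf_of_set (permutations_of_set {..<m}))
          (\<lambda>ks. subset_trace \<theta> (set (take c ks)))"
      unfolding 1 uniform_without_replacement_def integral_map_pmf
    proof (rule integral_cong_AE)
      show "AE ks in pmf_of_set (permutations_of_set {..<m}).
          exp_trace \<theta> (transpose_mat (sampling_matrix m c (take c ks) * Q) *
            (sampling_matrix m c (take c ks) * Q)) = subset_trace \<theta> (set (take c ks))"
      proof (rule AE_pmfI)
        fix ks assume "ks \<in> set_pmf (pmf_of_set (permutations_of_set {..<m}))"
        then have "ks \<in> permutations_of_set {..<m}" by (subst (asm) set_pmf_of_set) auto
        then have ks: "set ks = {..<m}" "distinct ks" by (auto simp: permutations_of_set_def)
        then have "set (take c ks) \<subseteq> {..<m}" using set_take_subset[of c ks] by auto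
        moreover have "real (count_list (take c ks) k) = indicator (set (take c ks)) k" for k
          using ks(2) by (auto simp: count_list_distinct indicator_def count_list_0_iff)
        ultimately show "exp_trace \<theta> (transpose_mat (sampling_matrix m c (take c ks) * Q) *
            (sampling_matrix m c (take c ks) * Q)) = subset_trace \<theta> (set (take c ks))"
          by (simp add: sampling_matrix_gram[OF Q] subset_trace_def)
      qed
    qed auto
    also have "\<dots> = (\<Sum>S\<in>{S. S \<subseteq> {..<m} \<and> card S = c}. subset_trace \<theta> S) / real (m choose c)"
      using expectation_permutation_take[of "{..<m}" c] cm by simp
    also have "\<dots> \<le> real n * (1 + ?g / real c) ^ c"
      using sum_subset_trace_le[OF \<theta> cm] cm
      by (simp add: pos_divide_le_eq zero_less_binomial mult_ac)
    finally show ?thesis using power_c by linarith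
  next
    case 2
    have "measure_pmf.expectation \<S> (\<lambda>S. exp_trace \<theta> (transpose_mat (S * Q) * (S * Q))) =
        measure_pmf.expectation (replicate_pmf c (pmf_of_set {..<m}))
          (\<lambda>ks. exp_trace \<theta> (G (\<lambda>k. real (count_list ks k))))"
      unfolding 2 uniform_with_replacement_def integral_map_pmf
    proof (rule integral_cong_AE)
      show "AE ks in replicate_pmf c (pmf_of_set {..<m}).
          exp_trace \<theta> (transpose_mat (sampling_matrix m c ks * Q) * (sampling_matrix m c ks * Q)) =
          exp_trace \<theta> (G (\<lambda>k. real (count_list ks k)))"
        using ne by (intro AE_pmfI)
          (auto simp: set_replicate_pmf lists_eq_set sampling_matrix_gram[OF Q])
    qed auto
    with expectation_replicate_le[OF \<theta>, of c] power_c show ?thesis by linarith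
  next
    case 3
    define q where "q = real c / real m"
    have q: "0 \<le> q" "q \<le> 1" using cm m_pos by (auto simp: q_def)
    let ?s = "sqrt (real m / real c)"
    \<comment> \<open>The diagonal is the image of a Boolean choice; \<open>False\<close> maps to
      the default 0, so the two product distributions agree outside the index range too.\<close>
    have "bernoulli_sampling m c = map_pmf (\<lambda>b. mat_diag m ((\<lambda>b. if b then ?s else 0) \<circ> b))
        (Pi_pmf {..<m} False (\<lambda>_. bernoulli_pmf q))"
      unfolding bernoulli_sampling_def q_def
      by (subst Pi_pmf_map[where dflt = False]) (auto simp: map_pmf_comp)
    moreover have "exp_trace \<theta> (transpose_mat (mat_diag m ((\<lambda>b. if b then ?s else 0) \<circ> b) * Q) *
        (mat_diag m ((\<lambda>b. if b then ?s else 0) \<circ> b) * Q)) = subset_trace \<theta> {k. b k}" for b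
      using diagonal_sampling_gram[OF Q, of "{k. b k}" c] by (simp add: subset_trace_def o_def)
    ultimately have "measure_pmf.expectation \<S> (\<lambda>S. exp_trace \<theta> (transpose_mat (S * Q) * (S * Q))) =
        measure_pmf.expectation (Pi_pmf {..<m} False (\<lambda>_. bernoulli_pmf q))
          (\<lambda>b. subset_trace \<theta> {k. b k})"
      using 3 by simp
    also have "\<dots> = (\<Sum>K\<le>m. q ^ K * (1 - q) ^ (m - K) *
        (\<Sum>S\<in>{S. S \<subseteq> {..<m} \<and> card S = K}. subset_trace \<theta> S))"
      using expectation_Pi_bernoulli[of "{..<m}" q "subset_trace \<theta>"] q by simp
    also have "\<dots> \<le> (\<Sum>K\<le>m. q ^ K * (1 - q) ^ (m - K) *
        (real (m choose K) * real n * (1 + ?g / real c) ^ K))"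
      using q \<theta> by (intro sum_mono mult_left_mono sum_subset_trace_le) auto
    \<comment> \<open>The binomial theorem evaluates the mixture; with \<open>q = c / m\<close> the
      base becomes \<open>1 + ?g / m\<close>.\<close>
    also have "\<dots> = real n * (\<Sum>K\<le>m. real (m choose K) * (q * (1 + ?g / real c)) ^ K * (1 - q) ^ (m - K))"
      by (simp add: sum_distrib_left power_mult_distrib mult_ac)
    also have "(\<Sum>K\<le>m. real (m choose K) * (q * (1 + ?g / real c)) ^ K * (1 - q) ^ (m - K)) =
        (q * (1 + ?g / real c) + (1 - q)) ^ m"
      by (rule binomial_ring[symmetric])
    also have "q * (1 + ?g / real c) + (1 - q) = 1 + ?g / real m"
      using c_ge_1 by (simp add: q_def algebra_simps)
    also have "real n * (1 + ?g / real m) ^ m \<le> real n * exp ?g"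
    proof (intro mult_left_mono one_plus_power_le_exp)
      have "0 \<le> q * (1 + ?g / real c) + (1 - q)"
        using mult_nonneg_nonneg[OF q(1) growth_factor_nonneg[of \<theta>]] q(2) by linarith
      also have "\<dots> = 1 + ?g / real m" using c_ge_1 by (simp add: q_def algebra_simps)
      finally show "0 \<le> 1 + ?g / real m" .
    qed (use m_pos in auto)
    finally show ?thesis .
  qed
qed

end

section \<open>Rank and condition number from bounds on the eigenvalues\<close>

text \<open>Nonnegativity also relies on the bound: the value at the zero vector is below the
  supremum once the set is bounded above.\<close>

lemma mnorm2_nonneg_le:
  assumes "0 \<le> B"
    and "\<And>v. v \<in> carrier_vec (dim_col A) \<Longrightarrow> (A *\<^sub>v v) \<bullet> (A *\<^sub>v v) \<le> B * (v \<bullet> v)"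
  shows "0 \<le> mnorm2 A" and "mnorm2 A \<le> sqrt B"
proof -
  let ?U = "{v \<in> carrier_vec (dim_col A). vnorm2 v \<le> 1}"
  have zero: "0\<^sub>v (dim_col A) \<in> ?U" by (simp add: vnorm2_def)
  have bound: "vnorm2 (A *\<^sub>v v) \<le> sqrt B" if "v \<in> ?U" for v
  proof -
    have "v \<bullet> v \<le> 1" using that by (simp add: vnorm2_def)
    then have "B * (v \<bullet> v) \<le> B * 1" using assms(1) by (intro mult_left_mono)
    then show ?thesis using assms(2)[of v] that by (simp add: vnorm2_def)
  qed
  show "mnorm2 A \<le> sqrt B" unfolding mnorm2_def
    by (rule cSUP_least) (use zero bound in blast)+
  have "vnorm2 (A *\<^sub>v 0\<^sub>v (dim_col A)) \<le> mnorm2 A" unfolding mnorm2_def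
    by (rule cSUP_upper[OF zero]) (use bound in \<open>auto intro!: bdd_aboveI2\<close>)
  then show "0 \<le> mnorm2 A" by (auto simp: vnorm2_def scalar_prod_self_nonneg intro: order_trans[rotated])
qed

lemma full_column_rank:
  fixes Z :: "real mat"
  assumes Z: "Z \<in> carrier_mat d n"
    and inj: "\<And>v. v \<in> carrier_vec n \<Longrightarrow> Z *\<^sub>v v = 0\<^sub>v d \<Longrightarrow> v = 0\<^sub>v n"
  shows "vec_space.rank d Z = n"
proof -
  interpret vec_space "TYPE(real)" d .
  \<comment> \<open>Linear independence concerns the set of columns, so repeated columns must be
    excluded first; they would put a difference of unit vectors into the kernel.\<close>
  have dist: "distinct (cols Z)"
  proof (rule ccontr)
    assume "\<not> distinct (cols Z)"
    then obtain i j where ij: "i < n" "j < n" "i \<noteq> j" and "cols Z ! i = cols Z ! j"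
      using Z by (auto simp: distinct_conv_nth)
    then have eq: "col Z i = col Z j" using Z by simp
    have unit: "Z *\<^sub>v unit_vec n k = col Z k" if "k < n" for k
      using Z that by (intro eq_vecI) auto
    have "Z *\<^sub>v (unit_vec n i - unit_vec n j) = Z *\<^sub>v unit_vec n i - Z *\<^sub>v unit_vec n j"
      using Z by (intro mult_minus_distrib_mat_vec) auto
    also have "\<dots> = 0\<^sub>v d"
      using Z ij eq unit by (intro eq_vecI) auto
    finally have "unit_vec n i - unit_vec n j = (0\<^sub>v n :: real vec)" using inj by simp
    then have "(unit_vec n i - unit_vec n j :: real vec) $ i = 0" using ij by simp
    then show False using ij by simp
  qed
  have "lin_indpt (set (cols Z))"
  proof
    assume "lin_dep (set (cols Z))"
    from lin_depE[OF Z this dist] inj show False by auto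
  qed
  from lin_indpt_full_rank[OF Z dist this] show ?thesis .
qed

text \<open>\<open>pinv\<close> is a definite description, so existence and uniqueness are both
  required before the Penrose conditions can be used.\<close>

lemma pinv_full_column_rank:
  fixes Z :: "real mat"
  assumes Z: "Z \<in> carrier_mat d n"
    and inj: "\<And>v. v \<in> carrier_vec n \<Longrightarrow> Z *\<^sub>v v = 0\<^sub>v d \<Longrightarrow> v = 0\<^sub>v n"
  shows "is_pinv Z (pinv Z)"
proof -
  let ?A = "transpose_mat Z * Z"
  have ZT: "transpose_mat Z \<in> carrier_mat n d" and A: "?A \<in> carrier_mat n n" using Z by auto
  have "det ?A \<noteq> 0"
  proof
    assume "det ?A = 0"
    then obtain v where v: "v \<in> carrier_vec n" "v \<noteq> 0\<^sub>v n" "?A *\<^sub>v v = 0\<^sub>v n"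
      using det_0_iff_vec_prod_zero_field[OF A] by blast
    have "(Z *\<^sub>v v) \<bullet> (Z *\<^sub>v v) = (transpose_mat Z *\<^sub>v (Z *\<^sub>v v)) \<bullet> v"
      using transpose_vec_mult_scalar[OF Z v(1), of "Z *\<^sub>v v"] Z v by simp
    also have "transpose_mat Z *\<^sub>v (Z *\<^sub>v v) = 0\<^sub>v n"
      using assoc_mult_mat_vec[OF ZT Z v(1)] v by simp
    finally have "(Z *\<^sub>v v) \<bullet> (Z *\<^sub>v v) = 0" using v by simp
    then have "Z *\<^sub>v v = 0\<^sub>v d"
      using scalar_prod_self_eq_0_iff[of "Z *\<^sub>v v" d] Z v by simp
    with inj v show False by blast
  qed
  from det_non_zero_imp_unit[OF A this, of "()"]
  obtain W where W: "W \<in> carrier_mat n n" "W * ?A = 1\<^sub>m n" "?A * W = 1\<^sub>m n"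
    unfolding Units_def ring_mat_def by auto
  have WT: "transpose_mat W = W"
  proof -
    have TA: "transpose_mat ?A = ?A" using Z ZT by (simp add: transpose_mult[OF ZT Z])
    have "transpose_mat W * ?A = transpose_mat (?A * W)"
      using transpose_mult[OF A W(1)] TA by simp
    also have "\<dots> = 1\<^sub>m n" using W by simp
    finally have *: "transpose_mat W * ?A = 1\<^sub>m n" .
    have "transpose_mat W = transpose_mat W * (?A * W)" using W by simp
    also have "\<dots> = (transpose_mat W * ?A) * W"
      using A W by (intro assoc_mult_mat[symmetric]) auto
    finally show ?thesis using * W by simp
  qed
  \<comment> \<open>The classical formula: the inverse of the Gram matrix times the
    transpose.\<close>
  define X where "X = W * transpose_mat Z"
  have X: "X \<in> carrier_mat n d" using W ZT by (simp add: X_def)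
  have XZ: "X * Z = 1\<^sub>m n" unfolding X_def using assoc_mult_mat[OF W(1) ZT Z] W by simp
  have sym: "transpose_mat (Z * X) = Z * X"
  proof -
    have "transpose_mat X = Z * W" unfolding X_def using transpose_mult[OF W(1) ZT] WT by simp
    then have "transpose_mat (Z * X) = (Z * W) * transpose_mat Z" using transpose_mult[OF Z X] by simp
    then show ?thesis using Z W ZT by (simp add: X_def)
  qed
  have pX: "is_pinv Z X"
    unfolding is_pinv_def using X Z XZ sym assoc_mult_mat[OF Z X Z] by simp
  \<comment> \<open>Both candidates are left inverses of \<open>Z\<close>, and \<open>Z * X\<close>
    and \<open>Z * Y\<close> are symmetric projections with the same range, hence equal.\<close>
  have "Y = X" if Y: "is_pinv Z Y" for Y
  proof -
    have Yc: "Y \<in> carrier_mat n d" and ZYZ: "Z * Y * Z = Z" and YZY: "Y * Z * Y = Y"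
      and sY: "transpose_mat (Z * Y) = Z * Y"
      using Y Z by (auto simp: is_pinv_def)
    note ZX = mult_carrier_mat[OF Z X] and ZY = mult_carrier_mat[OF Z Yc]
    have YZ: "Y * Z = 1\<^sub>m n"
    proof -
      have "Y * Z = (X * Z) * (Y * Z)" using XZ left_mult_one_mat[OF mult_carrier_mat[OF Yc Z]] by simp
      also have "\<dots> = X * (Z * (Y * Z))"
        by (rule assoc_mult_mat[OF X Z mult_carrier_mat[OF Yc Z]])
      also have "Z * (Y * Z) = Z" using assoc_mult_mat[OF Z Yc Z] ZYZ by simp
      finally show ?thesis using XZ by simp
    qed
    have "Z * Y = (Z * X) * (Z * Y)"
    proof -
      have "(Z * X) * (Z * Y) = ((Z * X) * Z) * Y" by (rule assoc_mult_mat[OF ZX Z Yc, symmetric])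
      then show ?thesis using pX by (simp add: is_pinv_def)
    qed
    from arg_cong[OF this, of transpose_mat] have "Z * Y = (Z * Y) * (Z * X)"
      using sY sym transpose_mult[OF ZX ZY] by simp
    also have "\<dots> = ((Z * Y) * Z) * X" by (rule assoc_mult_mat[OF ZY Z X, symmetric])
    finally have "Z * Y = Z * X" using ZYZ by simp
    have "Y = Y * (Z * Y)" using YZY assoc_mult_mat[OF Yc Z Yc] by simp
    also have "\<dots> = (Y * Z) * X" unfolding \<open>Z * Y = Z * X\<close>
      by (rule assoc_mult_mat[OF Yc Z X, symmetric])
    finally show ?thesis using YZ X by simp
  qed
  with pX show ?thesis unfolding pinv_def by (rule theI)
qed

text \<open>The lower bound gives injectivity, and also bounds \<open>pinv Z\<close>, because
  \<open>Z * pinv Z\<close> is an orthogonal projection and does not increase norms.\<close>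

lemma rank_and_cond_number:
  fixes Z :: "real mat"
  assumes Z: "Z \<in> carrier_mat d n" and lo: "lo > 0" and hi: "hi \<ge> 0"
    and lower: "\<And>x. x \<in> carrier_vec n \<Longrightarrow> lo * (x \<bullet> x) \<le> (Z *\<^sub>v x) \<bullet> (Z *\<^sub>v x)"
    and upper: "\<And>x. x \<in> carrier_vec n \<Longrightarrow> (Z *\<^sub>v x) \<bullet> (Z *\<^sub>v x) \<le> hi * (x \<bullet> x)"
  shows "vec_space.rank d Z = n" and "cond_number Z \<le> sqrt (hi / lo)"
proof -
  have inj: "v = 0\<^sub>v n" if v: "v \<in> carrier_vec n" "Z *\<^sub>v v = 0\<^sub>v d" for v
  proof -
    have "lo * (v \<bullet> v) \<le> 0" using lower[OF v(1)] v(2) by simp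
    then have "v \<bullet> v \<le> 0" using lo by (simp add: mult_le_0_iff)
    then have "v \<bullet> v = 0" using scalar_prod_self_nonneg[of v] by simp
    then show ?thesis using scalar_prod_self_eq_0_iff[OF v(1)] by simp
  qed
  show "vec_space.rank d Z = n" by (rule full_column_rank[OF Z inj])
  have "is_pinv Z (pinv Z)" by (rule pinv_full_column_rank[OF Z inj])
  then have X: "pinv Z \<in> carrier_mat n d" and ZXZ: "Z * pinv Z * Z = Z"
    and XZX: "pinv Z * Z * pinv Z = pinv Z" and sym: "transpose_mat (Z * pinv Z) = Z * pinv Z"
    using Z by (auto simp: is_pinv_def)
  let ?X = "pinv Z"
  have pinv_bound: "(?X *\<^sub>v y) \<bullet> (?X *\<^sub>v y) \<le> 1 / lo * (y \<bullet> y)" if y: "y \<in> carrier_vec d" for y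
  proof -
    \<comment> \<open>The projection of \<open>y\<close> to the range of \<open>Z\<close>; it is
      orthogonal to \<open>y - z\<close>, whose norm then yields the contraction.\<close>
    define z where "z = Z *\<^sub>v (?X *\<^sub>v y)"
    have Xy: "?X *\<^sub>v y \<in> carrier_vec n" using X y by simp
    have z: "z \<in> carrier_vec d" using Z Xy by (simp add: z_def)
    have P: "Z * ?X \<in> carrier_mat d d" using Z X by simp
    have zP: "z = (Z * ?X) *\<^sub>v y" using assoc_mult_mat_vec[OF Z X y] by (simp add: z_def)
    have "(Z * ?X) *\<^sub>v z = ((Z * ?X) * Z) *\<^sub>v (?X *\<^sub>v y)"
      unfolding z_def by (rule assoc_mult_mat_vec[OF P Z Xy, symmetric])
    then have Pz: "(Z * ?X) *\<^sub>v z = z" using ZXZ by (simp add: z_def)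
    have "z \<bullet> y = ((Z * ?X) *\<^sub>v z) \<bullet> y" by (simp add: Pz)
    also have "\<dots> = z \<bullet> ((Z * ?X) *\<^sub>v y)"
      by (rule symmetric_scalar_prod[OF P sym z y, symmetric])
    finally have zy: "z \<bullet> y = z \<bullet> z" by (simp add: zP)
    have "0 \<le> (y - z) \<bullet> (y - z)" by (rule scalar_prod_self_nonneg)
    also have "\<dots> = y \<bullet> y - z \<bullet> z"
      using y z zy comm_scalar_prod[OF y z]
      by (simp add: minus_scalar_prod_distrib[of _ d] scalar_prod_minus_distrib[of _ d])
    finally have "z \<bullet> z \<le> y \<bullet> y" by simp
    then have "lo * ((?X *\<^sub>v y) \<bullet> (?X *\<^sub>v y)) \<le> y \<bullet> y"
      using lower[OF Xy] by (simp add: z_def)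
    then show ?thesis using lo by (simp add: field_simps)
  qed
  have nZ: "0 \<le> mnorm2 Z" "mnorm2 Z \<le> sqrt hi"
    using mnorm2_nonneg_le[of hi Z] hi upper Z by auto
  have nX: "0 \<le> mnorm2 ?X" "mnorm2 ?X \<le> sqrt (1 / lo)"
    using mnorm2_nonneg_le[of "1 / lo" ?X] lo pinv_bound X by auto
  have "cond_number Z \<le> sqrt hi * sqrt (1 / lo)"
    unfolding cond_number_def using nZ nX hi by (intro mult_mono) auto
  then show "cond_number Z \<le> sqrt (hi / lo)" by (simp add: real_sqrt_divide)
qed

lemma gram_quadratic_form_bounds:
  fixes Z :: "real mat"
  assumes Z: "Z \<in> carrier_mat d n" and x: "x \<in> carrier_vec n"
    and ev: "\<And>i. i < n \<Longrightarrow> lo \<le> eigval (transpose_mat Z * Z) i \<and> eigval (transpose_mat Z * Z) i \<le> hi"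
  shows "lo * (x \<bullet> x) \<le> (Z *\<^sub>v x) \<bullet> (Z *\<^sub>v x)" and "(Z *\<^sub>v x) \<bullet> (Z *\<^sub>v x) \<le> hi * (x \<bullet> x)"
proof -
  let ?A = "transpose_mat Z * Z"
  have ZT: "transpose_mat Z \<in> carrier_mat n d" and A: "?A \<in> carrier_mat n n" using Z by auto
  have symA: "transpose_mat ?A = ?A" using transpose_mult[OF ZT Z] by simp
  note sys = eigensystem_eigvec_eigval[OF A symA]
  have u: "eigvec ?A i \<in> carrier_vec n" "?A *\<^sub>v eigvec ?A i = eigval ?A i \<cdot>\<^sub>v eigvec ?A i"
    if "i < n" for i using sys that by (auto simp: eigensystem_def)
  have Ax: "?A *\<^sub>v x \<in> carrier_vec n" using A x by simp
  have "(Z *\<^sub>v x) \<bullet> (Z *\<^sub>v x) = (?A *\<^sub>v x) \<bullet> x"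
    using transpose_vec_mult_scalar[OF Z x, of "Z *\<^sub>v x"] assoc_mult_mat_vec[OF ZT Z x] Z x by simp
  also have "\<dots> = (\<Sum>i<n. (eigvec ?A i \<bullet> (?A *\<^sub>v x)) * (eigvec ?A i \<bullet> x))"
    by (rule eigensystem_parseval[OF sys Ax x, symmetric])
  also have "\<dots> = (\<Sum>i<n. eigval ?A i * (eigvec ?A i \<bullet> x)\<^sup>2)"
  proof (intro sum.cong refl)
    fix i assume "i \<in> {..<n}"
    then have i: "i < n" by simp
    have "eigvec ?A i \<bullet> (?A *\<^sub>v x) = (?A *\<^sub>v eigvec ?A i) \<bullet> x"
      by (rule symmetric_scalar_prod[OF A symA u(1)[OF i] x])
    also have "\<dots> = eigval ?A i * (eigvec ?A i \<bullet> x)"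
      unfolding u(2)[OF i] by (rule smult_scalar_prod_distrib[OF u(1)[OF i] x])
    finally show "(eigvec ?A i \<bullet> (?A *\<^sub>v x)) * (eigvec ?A i \<bullet> x) = eigval ?A i * (eigvec ?A i \<bullet> x)\<^sup>2"
      by (simp add: power2_eq_square)
  qed
  finally have eq: "(Z *\<^sub>v x) \<bullet> (Z *\<^sub>v x) = (\<Sum>i<n. eigval ?A i * (eigvec ?A i \<bullet> x)\<^sup>2)" .
  have xx: "x \<bullet> x = (\<Sum>i<n. (eigvec ?A i \<bullet> x)\<^sup>2)"
    using eigensystem_parseval[OF sys x x] by (simp add: power2_eq_square)
  show "lo * (x \<bullet> x) \<le> (Z *\<^sub>v x) \<bullet> (Z *\<^sub>v x)" "(Z *\<^sub>v x) \<bullet> (Z *\<^sub>v x) \<le> hi * (x \<bullet> x)"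
    unfolding eq xx sum_distrib_left using ev by (auto intro!: sum_mono mult_right_mono)
qed

section \<open>The Chernoff bound\<close>

text \<open>Exponent of the upper tail. The derivative \<open>f'\<close> rises up to 1/2 and falls
  afterwards, so it suffices that it is nonnegative at 0 and at 1; at 1 this says that
  \<open>ln 2\<close> is at least 2/3.\<close>

lemma ln_one_plus_lower:
  fixes x :: real
  assumes "0 \<le> x" "x \<le> 1"
  shows "x + x\<^sup>2 / 3 \<le> (1 + x) * ln (1 + x)"
proof -
  define f where "f t = (1 + t) * ln (1 + t) - t - t\<^sup>2 / 3" for t :: real
  define f' where "f' t = ln (1 + t) - 2 * t / 3" for t :: real
  have f': "(f has_real_derivative f' t) (at t)" if "t \<ge> 0" for t
  proof -
    have "1 + t \<noteq> 0" using that by simp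
    with that show ?thesis unfolding f_def f'_def by (auto intro!: derivative_eq_intros)
  qed
  have f'': "(f' has_real_derivative 1 / (1 + t) - 2 / 3) (at t)" if "t \<ge> 0" for t
    unfolding f'_def using that by (auto intro!: derivative_eq_intros)
  have "0 \<le> f' t" if t: "0 \<le> t" "t \<le> 1" for t
  proof (cases "t \<le> 1 / 2")
    case True
    have "f' 0 \<le> f' t"
    proof (rule DERIV_nonneg_imp_nondecreasing[OF t(1)])
      fix u assume u: "0 \<le> u" "u \<le> t"
      then have "0 \<le> 1 / (1 + u) - 2 / 3" using True by (simp add: field_simps)
      with f''[OF u(1)] show "\<exists>d. (f' has_real_derivative d) (at u) \<and> 0 \<le> d" by blast
    qed
    then show ?thesis by (simp add: f'_def)
  next
    case False
    have "f' 1 \<le> f' t"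
    proof (rule DERIV_nonpos_imp_nonincreasing[OF t(2)])
      fix u assume u: "t \<le> u" "u \<le> 1"
      then have "1 / (1 + u) - 2 / 3 \<le> 0" using False by (simp add: field_simps)
      with f''[of u] u t show "\<exists>d. (f' has_real_derivative d) (at u) \<and> d \<le> 0" by force
    qed
    moreover have "0 \<le> f' 1" using ln2_ge_two_thirds by (simp add: f'_def)
    ultimately show ?thesis by simp
  qed
  then have "f 0 \<le> f x"
    using assms f' by (intro DERIV_nonneg_imp_nondecreasing[of 0 x f]) force+
  then show ?thesis by (simp add: f_def)
qed

text \<open>Exponent of the lower tail; \<open>ln (1 - t) \<le> - t\<close> makes the derivative of
  the difference nonnegative.\<close>

lemma ln_one_minus_lower:
  fixes x :: real
  assumes "0 \<le> x" "x < 1"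
  shows "- x + x\<^sup>2 / 3 \<le> (1 - x) * ln (1 - x)"
proof -
  define f where "f t = (1 - t) * ln (1 - t) + t - t\<^sup>2 / 3" for t :: real
  have "f 0 \<le> f x"
  proof (rule DERIV_nonneg_imp_nondecreasing[of 0 x f])
    fix t assume t: "0 \<le> t" "t \<le> x"
    then have "t < 1" using assms by simp
    have "(f has_real_derivative - ln (1 - t) - 2 * t / 3) (at t)"
    proof -
      have "1 - t \<noteq> 0" using \<open>t < 1\<close> by simp
      with \<open>t < 1\<close> show ?thesis unfolding f_def by (auto intro!: derivative_eq_intros)
    qed
    moreover have "ln (1 - t) \<le> - t" using ln_le_minus_one[of "1 - t"] \<open>t < 1\<close> by simp
    then have "0 \<le> - ln (1 - t) - 2 * t / 3" using t by simp
    ultimately show "\<exists>d. (f has_real_derivative d) (at t) \<and> 0 \<le> d" by blast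
  qed (use assms in simp)
  then show ?thesis by (simp add: f_def)
qed


section \<open>Tail bounds by Markov's inequality and the conclusion\<close>

lemma finite_set_pmf_sampling:
  assumes "m > 0" and "\<S> \<in> {uniform_without_replacement m c, uniform_with_replacement m c,
      bernoulli_sampling m c}"
  shows "finite (set_pmf \<S>)"
proof -
  have ne: "{..<m} \<noteq> {}" using assms by auto
  have "finite (set_pmf (replicate_pmf c (pmf_of_set {..<m})))"
    using ne by (intro finite_set_replicate_pmf) simp
  moreover have "finite (set_pmf (Pi_pmf {..<m} 0
      (\<lambda>_. map_pmf (\<lambda>b. if b then sqrt (real m / real c) else 0) (bernoulli_pmf (real c / real m)))))"
    by (subst set_Pi_pmf) auto
  ultimately show ?thesis
    using assms(2) ne by (auto simp: uniform_without_replacement_def uniform_with_replacement_def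
        bernoulli_sampling_def)
qed

lemma pmf_markov_inequality:
  fixes f :: "'a \<Rightarrow> real"
  assumes "finite (set_pmf p)" "\<And>x. 0 \<le> f x" "t > 0"
  shows "measure_pmf.prob p {x. t \<le> f x} \<le> measure_pmf.expectation p f / t"
  using integral_Markov_inequality_measure[of p f "{x. x \<in> UNIV}" t] assms
  by (auto simp: integrable_measure_pmf_finite)

text \<open>One statement for both tails: the sign of \<open>x\<close> is the sign of \<theta>, and
  the chosen \<theta> minimises \<open>growth \<theta> - \<theta> * (1 + x)\<close>.\<close>

lemma eigenvalue_tail_bound:
  fixes m n c :: nat and Q :: "real mat"
  assumes Q: "Q \<in> carrier_mat m n"
    and frame: "tight_frame n m (scaled_row m c Q) (real c) \<kappa>" and cm: "c \<le> m"
    and \<S>: "\<S> \<in> {uniform_without_replacement m c, uniform_with_replacement m c, bernoulli_sampling m c}"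
    and x: "x > -1" "x \<noteq> 0" and ent: "x + \<epsilon>\<^sup>2 / 3 \<le> (1 + x) * ln (1 + x)"
  defines "\<theta> \<equiv> ln (1 + x) / \<kappa>"
  shows "measure_pmf.prob \<S> {S. exp (\<theta> * (1 + x)) \<le> exp_trace \<theta> (transpose_mat (S * Q) * (S * Q))} \<le>
    real n * exp (- (\<epsilon>\<^sup>2 / (3 * \<kappa>)))"
proof -
  interpret tight_frame n m "scaled_row m c Q" "real c" \<kappa> by (rule frame)
  have \<theta>: "\<theta> \<noteq> 0" using x pos by (simp add: \<theta>_def)
  have g: "growth \<theta> = x / \<kappa>" using x pos by (simp add: growth_def \<theta>_def)
  have "measure_pmf.prob \<S> {S. exp (\<theta> * (1 + x)) \<le> exp_trace \<theta> (transpose_mat (S * Q) * (S * Q))} \<le>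
      measure_pmf.expectation \<S> (\<lambda>S. exp_trace \<theta> (transpose_mat (S * Q) * (S * Q))) / exp (\<theta> * (1 + x))"
    using finite_set_pmf_sampling[OF m_pos \<S>]
    by (intro pmf_markov_inequality) (auto simp: exp_trace_def sum_nonneg)
  also have "\<dots> \<le> real n * exp (growth \<theta>) / exp (\<theta> * (1 + x))"
    by (intro divide_right_mono expectation_exp_trace_le[OF Q frame cm \<S> \<theta>]) simp
  also have "\<dots> = real n * exp ((x - (1 + x) * ln (1 + x)) / \<kappa>)"
    unfolding g by (simp add: \<theta>_def diff_divide_distrib exp_diff mult.commute)
  also have "\<dots> \<le> real n * exp (- (\<epsilon>\<^sup>2 / (3 * \<kappa>)))"
  proof (intro mult_left_mono)
    have "(x - (1 + x) * ln (1 + x)) / \<kappa> \<le> (- (\<epsilon>\<^sup>2 / 3)) / \<kappa>"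
      using ent pos by (intro divide_right_mono) auto
    then show "exp ((x - (1 + x) * ln (1 + x)) / \<kappa>) \<le> exp (- (\<epsilon>\<^sup>2 / (3 * \<kappa>)))" by simp
  qed simp
  finally show ?thesis .
qed

lemma exp_eigval_le_exp_trace:
  "i < dim_row M \<Longrightarrow> exp (\<theta> * eigval M i) \<le> exp_trace \<theta> M"
  unfolding exp_trace_def by (rule member_le_sum) auto

theorem corollary4p2:
  fixes Q :: "real mat" and m n c :: nat and \<epsilon> \<delta> :: real and \<S> :: "real mat pmf"
  assumes "n \<ge> 1"
    and "Q \<in> carrier_mat m n"
    and "transpose_mat Q * Q = 1\<^sub>m n"
    and "n \<le> c" and "c \<le> m"
    and "\<S> \<in> {uniform_without_replacement m c, uniform_with_replacement m c,
               bernoulli_sampling m c}"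
    and "0 < \<epsilon>" and "\<epsilon> < 1" and "0 < \<delta>" and "\<delta> < 1"
    and "real c \<ge> 3 * real m * coherence Q * (ln (2 * real n / \<delta>) / \<epsilon>\<^sup>2)"
  shows "measure_pmf.prob \<S>
           {S. mat_rank (S * Q) = n \<and>
               cond_number (S * Q) \<le> sqrt ((1 + \<epsilon>) / (1 - \<epsilon>))} \<ge> 1 - \<delta>"
proof -
  note Q = assms(2) and \<S> = assms(6)
  have cm: "c \<ge> 1" "m \<ge> 1" using assms by auto
  define \<kappa> where "\<kappa> = real m * coherence Q / real c"
  note tf = tight_frame_scaled_row[OF Q assms(3,1) cm]
  have frame: "tight_frame n m (scaled_row m c Q) (real c) \<kappa>" using tf(1) by (simp add: \<kappa>_def)
  have \<kappa>: "\<kappa> > 0" using tf(2) cm by (simp add: \<kappa>_def)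
  define E where "E \<theta> x = {S. exp (\<theta> * (1 + x)) \<le> exp_trace \<theta> (transpose_mat (S * Q) * (S * Q))}"
    for \<theta> x
  define \<theta> where "\<theta> x = ln (1 + x) / \<kappa>" for x :: real
  \<comment> \<open>The sample size hypothesis solved for the logarithm, with \<open>c\<close>
    absorbed in \<kappa>.\<close>
  have "ln (2 * real n / \<delta>) \<le> \<epsilon>\<^sup>2 / (3 * \<kappa>)"
    using assms(11) \<kappa> \<open>0 < \<epsilon>\<close> tf(2) cm by (simp add: \<kappa>_def field_simps)
  then have "real n * exp (- (\<epsilon>\<^sup>2 / (3 * \<kappa>))) \<le> real n * exp (- ln (2 * real n / \<delta>))"
    by (intro mult_left_mono) auto
  also have "\<dots> = \<delta> / 2"
    using assms(1,9) by (simp add: exp_minus field_simps)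
  finally have half: "real n * exp (- (\<epsilon>\<^sup>2 / (3 * \<kappa>))) \<le> \<delta> / 2" .
  have upper: "measure_pmf.prob \<S> (E (\<theta> \<epsilon>) \<epsilon>) \<le> \<delta> / 2"
    using eigenvalue_tail_bound[OF Q frame assms(5) \<S>, of \<epsilon> \<epsilon>] ln_one_plus_lower[of \<epsilon>] assms(7,8) half
    by (simp add: E_def \<theta>_def)
  have lower: "measure_pmf.prob \<S> (E (\<theta> (- \<epsilon>)) (- \<epsilon>)) \<le> \<delta> / 2"
    using eigenvalue_tail_bound[OF Q frame assms(5) \<S>, of "- \<epsilon>" \<epsilon>] ln_one_minus_lower[of \<epsilon>] assms(7,8) half
    by (simp add: E_def \<theta>_def)
  define good where "good = {S. mat_rank (S * Q) = n \<and>
    cond_number (S * Q) \<le> sqrt ((1 + \<epsilon>) / (1 - \<epsilon>))}"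
  have "- good \<subseteq> E (\<theta> \<epsilon>) \<epsilon> \<union> E (\<theta> (- \<epsilon>)) (- \<epsilon>)"
  proof (rule subsetI, rule ccontr)
    fix S assume S: "S \<in> - good" and not_in: "S \<notin> E (\<theta> \<epsilon>) \<epsilon> \<union> E (\<theta> (- \<epsilon>)) (- \<epsilon>)"
    let ?Z = "S * Q"
    let ?A = "transpose_mat ?Z * ?Z"
    \<comment> \<open>The inclusion is shown for every matrix \<open>S\<close>, not only for
      possible samples; the number of columns of \<open>?Z\<close> comes from \<open>Q\<close>
      alone.\<close>
    have Z: "?Z \<in> carrier_mat (dim_row ?Z) n" using Q by auto
    have dimA: "dim_row ?A = n" using Q by simp
    have ev: "1 - \<epsilon> \<le> eigval ?A i \<and> eigval ?A i \<le> 1 + \<epsilon>" if "i < n" for i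
    proof -
      have "\<theta> x * eigval ?A i < \<theta> x * (1 + x)" if "S \<notin> E (\<theta> x) x" for x
      proof -
        have "exp (\<theta> x * eigval ?A i) \<le> exp_trace (\<theta> x) ?A"
          using exp_eigval_le_exp_trace \<open>i < n\<close> dimA by simp
        also have "\<dots> < exp (\<theta> x * (1 + x))" using that by (simp add: E_def not_le)
        finally show ?thesis by simp
      qed
      from this[of \<epsilon>] this[of "- \<epsilon>"] not_in
      \<comment> \<open>Dividing by the negative \<open>\<theta> (- \<epsilon>)\<close> reverses the
        second inequality into the lower bound on the eigenvalue.\<close>
      have "\<theta> \<epsilon> * eigval ?A i < \<theta> \<epsilon> * (1 + \<epsilon>)" "\<theta> (- \<epsilon>) * eigval ?A i < \<theta> (- \<epsilon>) * (1 - \<epsilon>)" by auto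
      moreover have "\<theta> \<epsilon> > 0" "\<theta> (- \<epsilon>) < 0" using \<kappa> assms(7,8) by (auto simp: \<theta>_def divide_neg_pos)
      ultimately show ?thesis by (auto simp: mult_less_cancel_left)
    qed
    note bounds = gram_quadratic_form_bounds[OF Z _ ev]
    have "S \<in> good"
      unfolding good_def using rank_and_cond_number[OF Z _ _ bounds] assms(7,8) by auto
    with S show False by simp
  qed
  then have "measure_pmf.prob \<S> (- good) \<le> measure_pmf.prob \<S> (E (\<theta> \<epsilon>) \<epsilon> \<union> E (\<theta> (- \<epsilon>)) (- \<epsilon>))"
    by (intro measure_pmf.finite_measure_mono) auto
  also have "\<dots> \<le> measure_pmf.prob \<S> (E (\<theta> \<epsilon>) \<epsilon>) + measure_pmf.prob \<S> (E (\<theta> (- \<epsilon>)) (- \<epsilon>))"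
    by (rule measure_Un_le) auto
  also have "\<dots> \<le> \<delta>" using upper lower by simp
  finally have "measure_pmf.prob \<S> (- good) \<le> \<delta>" .
  moreover have "measure_pmf.prob \<S> (- good) = 1 - measure_pmf.prob \<S> good"
    using measure_pmf.prob_compl[of good \<S>] by (simp add: Compl_eq_Diff_UNIV)
  ultimately show ?thesis by (simp add: good_def)
qed

end
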